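(* Let $N\geq 4$ and let $u=(u_{ij})_{i,j=1}^N\in M_N(C(S_N^+))$ be the generating magic unitary of $C(S_N^+)$. Then $S_N^+$ has free orbitals, i.e. for every $m\geq 1$ and all indices $i_1,\dots,i_m,j_1,\dots,j_m\in\{1,\dots,N\}$: if $u_{i_1j_1}u_{i_2j_2}\cdots u_{i_mj_m}=0$ in $C(S_N^+)$, then there is some $1\leq n\leq m-1$ such that exactly one of the equalities $i_n=i_{n+1}$, $j_n=j_{n+1}$ holds.
   Context: A magic unitary in a unital $\mathrm{C}^*$-algebra $\mathcal{A}$ is a matrix $v=(v_{ij})_{i,j=1}^N\in M_N(\mathcal{A})$ whose entries are projections ($v_{ij}=v_{ij}^*=v_{ij}^2$) with $\sum_{k}v_{ik}=1_{\mathcal{A}}=\sum_k v_{kj}$ for all $i,j$. Distinct entries in a common row, or in a common column, are then orthogonal. $C(S_N^+)$, the algebra of continuous functions on the quantum permutation group $S_N^+$, is the universal unital $\mathrm{C}^*$-algebra generated by the entries of an $N\times N$ magic unitary $u=(u_{ij})$. A monomial $u_{i_1j_1}\cdots u_{i_mj_m}$ is zero "for trivial reasons" if two consecutive factors are distinct entries lying in a common row or a common column, i.e. for some $n$ exactly one of $i_n=i_{n+1}$, $j_n=j_{n+1}$ holds. "Free $m$-orbitals" means that degree $m$ monomials vanish for trivial reasons only, and "free orbitals" means free $m$-orbitals for all $m\geq 1$. *)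

theory Defs
  imports "HOL-Analysis.Analysis" "HOL-Library.Poly_Mapping"
begin

section \<open>Unital C*-algebras and magic unitaries\<close>

text \<open>
  The class \<^class>\<open>real_normed_algebra_1\<close> contains the axiom \<open>1 \<noteq> 0\<close>, so the zero algebra is excluded.
\<close>

class cstar_algebra = real_normed_algebra_1 + banach +
  fixes scaleC :: "complex \<Rightarrow> 'a \<Rightarrow> 'a" (infixr \<open>*\<^sub>C\<close> 75)
    and star :: "'a \<Rightarrow> 'a"
  assumes scaleC_add_right: "a *\<^sub>C (x + y) = a *\<^sub>C x + a *\<^sub>C y"
    and scaleC_add_left: "(a + b) *\<^sub>C x = a *\<^sub>C x + b *\<^sub>C x"
    and scaleC_scaleC: "a *\<^sub>C b *\<^sub>C x = (a * b) *\<^sub>C x"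
    and scaleC_of_real: "complex_of_real r *\<^sub>C x = r *\<^sub>R x"
    and mult_scaleC_left: "(a *\<^sub>C x) * y = a *\<^sub>C (x * y)"
    and mult_scaleC_right: "x * (a *\<^sub>C y) = a *\<^sub>C (x * y)"
    and norm_scaleC: "norm (a *\<^sub>C x) = cmod a * norm x"
    and star_star: "star (star x) = x"
    and star_add: "star (x + y) = star x + star y"
    and star_scaleC: "star (a *\<^sub>C x) = cnj a *\<^sub>C star x"
    and star_mult: "star (x * y) = star y * star x"
    and norm_star_mult: "norm (star x * x) = (norm x)\<^sup>2"

definition magic_unitary :: "('n::finite \<Rightarrow> 'n \<Rightarrow> 'a::cstar_algebra) \<Rightarrow> bool" where
  "magic_unitary v \<longleftrightarrow>
     (\<forall>i j. v i j = star (v i j) \<and> v i j = v i j * v i j) \<and>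
     (\<forall>i. (\<Sum>k\<in>UNIV. v i k) = 1) \<and> (\<forall>j. (\<Sum>k\<in>UNIV. v k j) = 1)"

definition unital_star_hom :: "('a::cstar_algebra \<Rightarrow> 'b::cstar_algebra) \<Rightarrow> bool" where
  "unital_star_hom \<phi> \<longleftrightarrow>
     (\<forall>x y. \<phi> (x + y) = \<phi> x + \<phi> y) \<and> (\<forall>c x. \<phi> (c *\<^sub>C x) = c *\<^sub>C \<phi> x) \<and>
     (\<forall>x y. \<phi> (x * y) = \<phi> x * \<phi> y) \<and> \<phi> 1 = 1 \<and> (\<forall>x. \<phi> (star x) = star (\<phi> x))"

instantiation complex :: cstar_algebra
begin
definition "scaleC_complex (a::complex) (x::complex) = a * x"
definition "star_complex (x::complex) = cnj x"
instance
  by standard (simp_all add: scaleC_complex_def star_complex_def algebra_simps norm_mult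
      scaleR_conv_of_real power2_eq_square)
end


section \<open>The free unital *-algebra\<close>

text \<open>
  A letter \<open>(e, False)\<close> stands for the generator \<open>e\<close>, the letter \<open>(e, True)\<close> for its adjoint.
  The monoid of words is written additively, so that the convolution product of
  \<^type>\<open>poly_mapping\<close> is the product of the free algebra.
\<close>

datatype 'e star_word = Word (letters: "('e \<times> bool) list")

instantiation star_word :: (type) monoid_add
begin
definition "0 = Word []"
definition "v + w = Word (letters v @ letters w)"
instance
  by standard (simp_all add: zero_star_word_def plus_star_word_def)
end

type_synonym 'e free_star_algebra = "'e star_word \<Rightarrow>\<^sub>0 complex"

definition free_gen :: "'e \<Rightarrow> 'e free_star_algebra" where
  "free_gen e = Poly_Mapping.single (Word [(e, False)]) 1"

definition free_scale :: "complex \<Rightarrow> 'e free_star_algebra \<Rightarrow> 'e free_star_algebra" where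
  "free_scale c x = Poly_Mapping.single 0 c * x"

definition word_star :: "'e star_word \<Rightarrow> 'e star_word" where
  "word_star w = Word (rev (map (\<lambda>(e, s). (e, \<not> s)) (letters w)))"

definition free_star :: "'e free_star_algebra \<Rightarrow> 'e free_star_algebra" where
  "free_star x = (\<Sum>w\<in>Poly_Mapping.keys x.
     Poly_Mapping.single (word_star w) (cnj (Poly_Mapping.lookup x w)))"

lemma star_word_add [simp]: "Word v + Word w = Word (v @ w)"
  by (simp add: plus_star_word_def)

lemma word_star_add: "word_star (v + w) = word_star w + word_star v"
  by (simp add: word_star_def plus_star_word_def)

lemma word_star_word_star [simp]: "word_star (word_star w) = w"
  by (cases w) (simp add: word_star_def rev_map comp_def case_prod_unfold)

lemma word_star_zero [simp]: "word_star 0 = 0"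
  by (simp add: word_star_def zero_star_word_def)

lemma linear_ext_add:
  fixes h :: "'k \<Rightarrow> complex \<Rightarrow> 'b::ab_group_add"
  assumes h: "\<And>w a b. h w (a + b) = h w a + h w b"
  shows "(\<Sum>w\<in>Poly_Mapping.keys (x + y). h w (Poly_Mapping.lookup (x + y) w)) =
         (\<Sum>w\<in>Poly_Mapping.keys x. h w (Poly_Mapping.lookup x w)) +
         (\<Sum>w\<in>Poly_Mapping.keys y. h w (Poly_Mapping.lookup y w))"
proof -
  let ?K = "Poly_Mapping.keys x \<union> Poly_Mapping.keys y"
  have h0: "h w 0 = 0" for w using h[of w 0 0] by simp
  have *: "(\<Sum>w\<in>Poly_Mapping.keys z. h w (Poly_Mapping.lookup z w)) =
           (\<Sum>w\<in>?K. h w (Poly_Mapping.lookup z w))" if "Poly_Mapping.keys z \<subseteq> ?K" for z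
    by (rule sum.mono_neutral_left) (use that in \<open>auto simp: h0 in_keys_iff\<close>)
  show ?thesis
    by (subst (1 2 3) *) (use Poly_Mapping.keys_add[of x y] in \<open>auto simp: lookup_add h sum.distrib\<close>)
qed

lemma linear_ext_single:
  assumes "h w 0 = 0"
  shows "(\<Sum>w'\<in>Poly_Mapping.keys (Poly_Mapping.single w c). h w' (Poly_Mapping.lookup (Poly_Mapping.single w c) w')) = h w c"
  using assms by (cases "c = 0") auto

lemma free_induct [case_names single add]:
  fixes x :: "'k \<Rightarrow>\<^sub>0 complex"
  assumes s: "\<And>w c. P (Poly_Mapping.single w c)" and a: "\<And>x y. P x \<Longrightarrow> P y \<Longrightarrow> P (x + y)"
  shows "P x"
proof -
  have 0: "P 0" using s[of undefined 0] by simp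
  have "x = (\<Sum>w\<in>Poly_Mapping.keys x. Poly_Mapping.single w (Poly_Mapping.lookup x w))"
    by (rule poly_mapping_eqI)
       (auto simp: lookup_sum lookup_single when_def in_keys_iff if_distrib cong: if_cong)
  moreover have "P (\<Sum>w\<in>A. Poly_Mapping.single w (Poly_Mapping.lookup x w))" if "finite A" for A
    using that by (induction A) (auto intro: 0 s a)
  ultimately show ?thesis by (metis finite_keys)
qed

lemma free_star_add: "free_star (x + y) = free_star x + free_star y"
  unfolding free_star_def by (rule linear_ext_add) (simp add: single_add)

lemma free_star_single [simp]:
  "free_star (Poly_Mapping.single w c) = Poly_Mapping.single (word_star w) (cnj c)"
  unfolding free_star_def by (rule linear_ext_single) simp

lemma free_star_zero [simp]: "free_star 0 = 0"
  using free_star_add[of 0 0] by simp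

lemma free_star_minus: "free_star (- x) = - free_star x"
  using free_star_add[of x "- x"] by (simp add: eq_neg_iff_add_eq_0 add.commute)

lemma free_star_diff: "free_star (x - y) = free_star x - free_star y"
  using free_star_add[of x "- y"] by (simp add: free_star_minus)

lemma free_star_star [simp]: "free_star (free_star x) = x"
  by (induction x rule: free_induct) (simp_all add: free_star_add)

lemma free_star_mult: "free_star (x * y) = free_star y * free_star x"
proof (induction x rule: free_induct)
  case (single w c)
  show ?case
    by (induction y rule: free_induct)
       (simp_all add: distrib_left distrib_right free_star_add mult_single word_star_add mult.commute)
qed (simp_all add: distrib_left distrib_right free_star_add)

lemma free_star_one [simp]: "free_star 1 = 1"
  using free_star_single[of 0 1] by (simp del: free_star_single)

lemma single_0_central:
  fixes x :: "'e free_star_algebra"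
  shows "Poly_Mapping.single 0 c * x = x * Poly_Mapping.single 0 c"
  by (induction x rule: free_induct) (simp_all add: distrib_left distrib_right mult_single mult.commute)

lemma free_scale_add: "free_scale c (x + y) = free_scale c x + free_scale c y"
  and free_scale_diff: "free_scale c (x - y) = free_scale c x - free_scale c y"
  and free_scale_add_left: "free_scale (c + d) x = free_scale c x + free_scale d x"
  and free_scale_scale: "free_scale c (free_scale d x) = free_scale (c * d) x"
  and free_scale_one [simp]: "free_scale 1 x = x"
  and free_scale_zero [simp]: "free_scale 0 x = 0"
  and free_scale_minus: "free_scale (-1) x = - x"
  and free_scale_mult_left: "free_scale c x * y = free_scale c (x * y)"
  and free_scale_mult_right: "x * free_scale c y = free_scale c (x * y)"
  and free_star_scale: "free_star (free_scale c x) = free_scale (cnj c) (free_star x)"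
proof -
  show "x * free_scale c y = free_scale c (x * y)"
    unfolding free_scale_def by (metis mult.assoc single_0_central)
  show "free_star (free_scale c x) = free_scale (cnj c) (free_star x)"
    unfolding free_scale_def free_star_mult by (simp add: single_0_central)
  show "free_scale (-1) x = - x"
    by (simp add: free_scale_def single_uminus)
qed (simp_all add: free_scale_def distrib_left distrib_right right_diff_distrib single_add mult_single
       flip: mult.assoc)


section \<open>The universal C*-seminorm\<close>

definition cstar_seminorm :: "('e free_star_algebra \<Rightarrow> real) \<Rightarrow> bool" where
  "cstar_seminorm p \<longleftrightarrow>
     (\<forall>x y. p (x + y) \<le> p x + p y) \<and>
     (\<forall>c x. p (free_scale c x) = cmod c * p x) \<and>
     (\<forall>x y. p (x * y) \<le> p x * p y) \<and>
     (\<forall>x. p (free_star x * x) = (p x)\<^sup>2)"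

definition magic_relations :: "('n::finite \<times> 'n) free_star_algebra set" where
  "magic_relations =
     (\<Union>i j. {free_star (free_gen (i, j)) - free_gen (i, j),
              free_gen (i, j) * free_gen (i, j) - free_gen (i, j)}) \<union>
     (\<Union>i. {(\<Sum>k\<in>UNIV. free_gen (i, k)) - 1}) \<union>
     (\<Union>j. {(\<Sum>k\<in>UNIV. free_gen (k, j)) - 1})"

definition magic_seminorm :: "(('n::finite \<times> 'n) free_star_algebra \<Rightarrow> real) \<Rightarrow> bool" where
  "magic_seminorm p \<longleftrightarrow> cstar_seminorm p \<and> (\<forall>r\<in>magic_relations. p r = 0)"

text \<open>
  The supremum is that of a nonempty bounded set, see \<open>magic_seminorm_zero\<close> and
  \<open>magic_seminorm_bound\<close> below.
\<close>

definition univ_seminorm :: "('n::finite \<times> 'n) free_star_algebra \<Rightarrow> real" where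
  "univ_seminorm x = (SUP p\<in>{p. magic_seminorm p}. p x)"

context
  fixes p :: "'e free_star_algebra \<Rightarrow> real"
  assumes p: "cstar_seminorm p"
begin

lemma cstar_seminorm_add: "p (x + y) \<le> p x + p y"
  and cstar_seminorm_scale: "p (free_scale c x) = cmod c * p x"
  and cstar_seminorm_mult: "p (x * y) \<le> p x * p y"
  and cstar_seminorm_star_mult: "p (free_star x * x) = (p x)\<^sup>2"
  using p by (simp_all add: cstar_seminorm_def)

lemma cstar_seminorm_zero: "p 0 = 0"
  using cstar_seminorm_scale[of 0 0] by simp

lemma cstar_seminorm_minus: "p (- x) = p x"
  using cstar_seminorm_scale[of "-1" x] by (simp add: free_scale_minus)

lemma cstar_seminorm_nonneg: "0 \<le> p x"
  using cstar_seminorm_add[of x "- x"] by (simp add: cstar_seminorm_zero cstar_seminorm_minus)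

lemma cstar_seminorm_diff_commute: "p (x - y) = p (y - x)"
  using cstar_seminorm_minus[of "x - y"] by simp

lemma cstar_seminorm_diff_triangle: "p (x - z) \<le> p (x - y) + p (y - z)"
  using cstar_seminorm_add[of "x - y" "y - z"] by simp

lemma cstar_seminorm_diff: "\<bar>p x - p y\<bar> \<le> p (x - y)"
  using cstar_seminorm_add[of "x - y" y] cstar_seminorm_add[of "y - x" x]
  by (simp add: cstar_seminorm_diff_commute[of y x])

lemma cstar_seminorm_cong: "p (x - y) = 0 \<Longrightarrow> p x = p y"
  using cstar_seminorm_diff[of x y] by simp

lemma cstar_seminorm_star: "p (free_star x) = p x"
proof -
  have le: "p x \<le> p (free_star x)" for x
  proof (cases "p x = 0")
    case False
    have "p x * p x \<le> p (free_star x) * p x"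
      using cstar_seminorm_mult[of "free_star x" x] by (simp add: cstar_seminorm_star_mult power2_eq_square)
    then show ?thesis using False cstar_seminorm_nonneg[of x] by simp
  qed (simp add: cstar_seminorm_nonneg)
  show ?thesis using le[of x] le[of "free_star x"] by simp
qed

lemma cstar_seminorm_one: "p 1 \<le> 1"
  using cstar_seminorm_star_mult[of 1] by (auto simp: power2_eq_square)

lemma cstar_seminorm_sum: "p (\<Sum>w\<in>A. f w) \<le> (\<Sum>w\<in>A. p (f w))"
proof (induction A rule: infinite_finite_induct)
  case (insert a A)
  then show ?case using cstar_seminorm_add[of "f a" "\<Sum>w\<in>A. f w"] by simp
qed (simp_all add: cstar_seminorm_zero)

end

lemma magic_seminorm_zero: "magic_seminorm (\<lambda>_. 0)"
  by (simp add: magic_seminorm_def cstar_seminorm_def)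

lemma magic_seminorm_gen:
  assumes "magic_seminorm p" shows "p (free_gen (i, j)) \<le> 1"
proof -
  let ?g = "free_gen (i, j)"
  have p: "cstar_seminorm p" using assms by (simp add: magic_seminorm_def)
  have s: "p (free_star ?g - ?g) = 0" and m: "p (?g * ?g - ?g) = 0"
    using assms unfolding magic_seminorm_def magic_relations_def by blast+
  have "p ((free_star ?g - ?g) * ?g) = 0"
    using cstar_seminorm_mult[OF p, of "free_star ?g - ?g" ?g] s
      cstar_seminorm_nonneg[OF p, of "(free_star ?g - ?g) * ?g"] by simp
  then have "p (free_star ?g * ?g) = p (?g * ?g)"
    by (intro cstar_seminorm_cong[OF p]) (simp add: left_diff_distrib)
  then have "(p ?g)\<^sup>2 = p ?g"
    using cstar_seminorm_cong[OF p m] by (simp add: cstar_seminorm_star_mult[OF p])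
  then show ?thesis by (auto simp: power2_eq_square)
qed

lemma magic_seminorm_bound:
  assumes "magic_seminorm p"
  shows "p x \<le> (\<Sum>w\<in>Poly_Mapping.keys x. cmod (Poly_Mapping.lookup x w))"
proof -
  have p: "cstar_seminorm p" using assms by (simp add: magic_seminorm_def)
  have letter: "p (Poly_Mapping.single (Word [(e, s)]) 1) \<le> 1" for e s
  proof -
    obtain i j where e: "e = (i, j)" by force
    have "p (Poly_Mapping.single (Word [(e, True)]) 1) = p (free_star (free_gen e))"
      by (simp add: free_gen_def word_star_def[of "Word _"])
    then show ?thesis
      using magic_seminorm_gen[OF assms, of i j] e
      by (cases s) (simp_all add: cstar_seminorm_star[OF p], simp add: free_gen_def)
  qed
  have word: "p (Poly_Mapping.single (Word l) 1) \<le> 1" for l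
  proof (induction l)
    case Nil
    then show ?case using cstar_seminorm_one[OF p] by (simp flip: zero_star_word_def)
  next
    case (Cons a l)
    obtain e s where a: "a = (e, s)" by (cases a)
    have "p (Poly_Mapping.single (Word (a # l)) 1) =
          p (Poly_Mapping.single (Word [a]) 1 * Poly_Mapping.single (Word l) 1)"
      by (simp add: mult_single)
    also have "\<dots> \<le> 1 * 1"
      using a by (intro order.trans[OF cstar_seminorm_mult[OF p]] mult_mono letter Cons)
                 (auto simp: cstar_seminorm_nonneg[OF p] letter)
    finally show ?case by simp
  qed
  have single: "p (Poly_Mapping.single w c) \<le> cmod c" for w c
  proof -
    obtain l where l: "w = Word l" by (cases w)
    have "Poly_Mapping.single w c = free_scale c (Poly_Mapping.single w 1)"
      by (simp add: free_scale_def mult_single)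
    then show ?thesis using word[of l] l
      by (simp add: cstar_seminorm_scale[OF p] mult_left_le)
  qed
  have "x = (\<Sum>w\<in>Poly_Mapping.keys x. Poly_Mapping.single w (Poly_Mapping.lookup x w))"
    by (rule poly_mapping_eqI)
       (auto simp: lookup_sum lookup_single when_def in_keys_iff if_distrib cong: if_cong)
  then have "p x \<le> (\<Sum>w\<in>Poly_Mapping.keys x. p (Poly_Mapping.single w (Poly_Mapping.lookup x w)))"
    using cstar_seminorm_sum[OF p] by metis
  also have "\<dots> \<le> (\<Sum>w\<in>Poly_Mapping.keys x. cmod (Poly_Mapping.lookup x w))"
    by (intro sum_mono single)
  finally show ?thesis .
qed

lemma magic_seminorm_le_univ:
  assumes "magic_seminorm p" shows "p x \<le> univ_seminorm x"
  unfolding univ_seminorm_def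
  using assms magic_seminorm_bound
  by (intro cSUP_upper) (auto intro!: bdd_aboveI2[where M = "\<Sum>w\<in>Poly_Mapping.keys x. cmod (Poly_Mapping.lookup x w)"])

lemma univ_seminorm_least:
  assumes "\<And>p. magic_seminorm p \<Longrightarrow> p x \<le> b" shows "univ_seminorm x \<le> b"
  unfolding univ_seminorm_def using assms magic_seminorm_zero by (intro cSUP_least) auto

lemma univ_seminorm_magic:
  "magic_seminorm (univ_seminorm :: ('a::finite \<times> 'a) free_star_algebra \<Rightarrow> real)"
proof -
  note up = magic_seminorm_le_univ
  have S: "cstar_seminorm p" if "magic_seminorm p" for p :: "('a \<times> 'a) free_star_algebra \<Rightarrow> real"
    using that by (simp add: magic_seminorm_def)
  have nn: "0 \<le> univ_seminorm x" for x :: "('a \<times> 'a) free_star_algebra"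
    by (rule up[OF magic_seminorm_zero])
  have add: "univ_seminorm (x + y) \<le> univ_seminorm x + univ_seminorm y" for x y :: "('a \<times> 'a) free_star_algebra"
    by (rule univ_seminorm_least)
       (meson S cstar_seminorm_add order.trans add_mono up)
  have le: "univ_seminorm (free_scale c x) \<le> cmod c * univ_seminorm x" for c and x :: "('a \<times> 'a) free_star_algebra"
    by (rule univ_seminorm_least) (simp add: cstar_seminorm_scale[OF S] up mult_left_mono)
  have scale: "univ_seminorm (free_scale c x) = cmod c * univ_seminorm x" for c and x :: "('a \<times> 'a) free_star_algebra"
  proof (cases "c = 0")
    case True
    then show ?thesis using le[of c x] nn[of "free_scale c x"] by simp
  next
    case False
    then show ?thesis using le[of c x] le[of "inverse c" "free_scale c x"]
      by (simp add: free_scale_scale norm_inverse norm_divide field_simps)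
  qed
  have mult: "univ_seminorm (x * y) \<le> univ_seminorm x * univ_seminorm y" for x y :: "('a \<times> 'a) free_star_algebra"
  proof (rule univ_seminorm_least)
    fix p :: "('a \<times> 'a) free_star_algebra \<Rightarrow> real" assume p: "magic_seminorm p"
    have "p (x * y) \<le> p x * p y" by (rule cstar_seminorm_mult[OF S[OF p]])
    also have "\<dots> \<le> univ_seminorm x * univ_seminorm y"
      by (intro mult_mono up[OF p] nn cstar_seminorm_nonneg[OF S[OF p]])
    finally show "p (x * y) \<le> univ_seminorm x * univ_seminorm y" .
  qed
  have cstar: "univ_seminorm (free_star x * x) = (univ_seminorm x)\<^sup>2" for x :: "('a \<times> 'a) free_star_algebra"
  proof (rule antisym)
    show "univ_seminorm (free_star x * x) \<le> (univ_seminorm x)\<^sup>2"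
      by (rule univ_seminorm_least)
         (simp add: cstar_seminorm_star_mult[OF S] up power_mono cstar_seminorm_nonneg[OF S])
    have "univ_seminorm x \<le> sqrt (univ_seminorm (free_star x * x))"
    proof (rule univ_seminorm_least)
      fix p :: "('a \<times> 'a) free_star_algebra \<Rightarrow> real" assume p: "magic_seminorm p"
      show "p x \<le> sqrt (univ_seminorm (free_star x * x))"
        using up[OF p, of "free_star x * x"]
        by (intro real_le_rsqrt) (simp add: cstar_seminorm_star_mult[OF S[OF p]])
    qed
    then show "(univ_seminorm x)\<^sup>2 \<le> univ_seminorm (free_star x * x)"
      using nn by (metis real_sqrt_le_iff real_sqrt_abs abs_of_nonneg)
  qed
  have "univ_seminorm r = 0" if "r \<in> magic_relations" for r :: "('a \<times> 'a) free_star_algebra"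
    using that by (intro antisym nn univ_seminorm_least) (simp add: magic_seminorm_def)
  then show ?thesis
    by (simp add: magic_seminorm_def cstar_seminorm_def add scale mult cstar)
qed

lemmas univ_seminorm_cstar = univ_seminorm_magic[unfolded magic_seminorm_def, THEN conjunct1]
lemmas univ_seminorm_relation = univ_seminorm_magic[unfolded magic_seminorm_def, THEN conjunct2, rule_format]


section \<open>Evaluation of the free *-algebra at a magic unitary\<close>

context
  fixes v :: "'e \<Rightarrow> 'a::cstar_algebra"
begin

fun word_eval :: "('e \<times> bool) list \<Rightarrow> 'a" where
  "word_eval [] = 1"
| "word_eval ((e, s) # l) = (if s then star (v e) else v e) * word_eval l"

definition free_eval :: "'e free_star_algebra \<Rightarrow> 'a" where
  "free_eval x = (\<Sum>w\<in>Poly_Mapping.keys x. Poly_Mapping.lookup x w *\<^sub>C word_eval (letters w))"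

end

lemma scaleC_zero_left [simp]: "0 *\<^sub>C (x::'a::cstar_algebra) = 0"
  using scaleC_add_left[of 0 0 x] by simp

lemma scaleC_zero_right [simp]: "a *\<^sub>C (0::'a::cstar_algebra) = 0"
  using scaleC_add_right[of a 0 "0::'a"] by simp

lemma scaleC_one [simp]: "1 *\<^sub>C (x::'a::cstar_algebra) = x"
  using scaleC_of_real[of 1 x] by simp

lemma star_zero [simp]: "star (0::'a::cstar_algebra) = 0"
  using star_add[of "0::'a" 0] by simp

lemma star_one [simp]: "star (1::'a::cstar_algebra) = 1"
  by (metis mult_1 mult_1_right star_mult star_star)

lemma norm_star: "norm (star a) = norm (a::'a::cstar_algebra)"
proof -
  have "norm b \<le> norm (star b)" for b :: 'a
    using norm_mult_ineq[of "star b" b] norm_star_mult[of b]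
    by (cases "b = 0") (simp_all add: power2_eq_square)
  from this[of a] this[of "star a"] show ?thesis by (simp add: star_star)
qed

lemma bounded_linear_scaleC: "bounded_linear (\<lambda>x::'a::cstar_algebra. c *\<^sub>C x)"
  by (rule bounded_linear_intro[where K = "cmod c"])
     (simp_all add: scaleC_add_right norm_scaleC scaleC_scaleC mult.commute flip: scaleC_of_real)

lemma bounded_linear_star: "bounded_linear (star :: 'a::cstar_algebra \<Rightarrow> 'a)"
  by (rule bounded_linear_intro[where K = 1])
     (simp_all add: star_add norm_star star_scaleC flip: scaleC_of_real)

lemma free_eval_add: "free_eval v (x + y) = free_eval v x + free_eval v y"
  unfolding free_eval_def by (rule linear_ext_add) (simp add: scaleC_add_left)

lemma free_eval_single: "free_eval v (Poly_Mapping.single w c) = c *\<^sub>C word_eval v (letters w)"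
  unfolding free_eval_def by (rule linear_ext_single) simp

lemma free_eval_zero [simp]: "free_eval v 0 = 0"
  using free_eval_add[of v 0 0] by simp

lemma free_eval_diff: "free_eval v (x - y) = free_eval v x - free_eval v y"
  using free_eval_add[of v "x - y" y] by simp

lemma free_eval_sum: "free_eval v (\<Sum>k\<in>A. f k) = (\<Sum>k\<in>A. free_eval v (f k))"
  by (induction A rule: infinite_finite_induct) (simp_all add: free_eval_add)

lemma word_eval_append: "word_eval v (l @ l') = word_eval v l * word_eval v l'"
  by (induction l) (auto simp: mult.assoc)

lemma word_eval_star: "word_eval v (letters (word_star w)) = star (word_eval v (letters w))"
proof -
  have "word_eval v (rev (map (\<lambda>(e, s). (e, \<not> s)) l)) = star (word_eval v l)" for l
    by (induction l) (auto simp: word_eval_append star_mult star_star)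
  then show ?thesis by (simp add: word_star_def)
qed

lemma free_eval_mult: "free_eval v (x * y) = free_eval v x * free_eval v y"
proof (induction x rule: free_induct)
  case (single w c)
  show ?case
    by (induction y rule: free_induct)
       (simp_all add: distrib_left distrib_right free_eval_add mult_single free_eval_single
         plus_star_word_def word_eval_append mult_scaleC_left mult_scaleC_right scaleC_scaleC mult.commute[of c])
qed (simp_all add: distrib_left distrib_right free_eval_add)

lemma free_eval_one [simp]: "free_eval v 1 = 1"
  using free_eval_single[of v 0 1] by (simp add: zero_star_word_def[symmetric], simp add: zero_star_word_def)

lemma free_eval_star: "free_eval v (free_star x) = star (free_eval v x)"
  by (induction x rule: free_induct)
     (simp_all add: free_star_add free_eval_add star_add free_eval_single word_eval_star star_scaleC)

lemma free_eval_scale: "free_eval v (free_scale c x) = c *\<^sub>C free_eval v x"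
  by (simp add: free_scale_def free_eval_mult free_eval_single zero_star_word_def mult_scaleC_left)

lemma free_eval_gen: "free_eval v (free_gen e) = v e"
  by (simp add: free_gen_def free_eval_single)

lemma magic_seminorm_free_eval:
  assumes "magic_unitary v"
  shows "magic_seminorm (\<lambda>x. norm (free_eval (\<lambda>(i, j). v i j) x))"
proof -
  have "cstar_seminorm (\<lambda>x. norm (free_eval (\<lambda>(i, j). v i j) x))"
    by (simp add: cstar_seminorm_def free_eval_add free_eval_mult free_eval_star free_eval_scale
        norm_triangle_ineq norm_mult_ineq norm_scaleC norm_star_mult)
  moreover have "free_eval (\<lambda>(i, j). v i j) r = 0" if "r \<in> magic_relations" for r
    using that assms
    by (auto simp: magic_relations_def magic_unitary_def free_eval_diff free_eval_mult
        free_eval_star free_eval_gen free_eval_sum)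
  ultimately show ?thesis by (simp add: magic_seminorm_def)
qed

lemma univ_seminorm_one: "univ_seminorm (1 :: ('n::finite \<times> 'n) free_star_algebra) = 1"
proof -
  have "magic_unitary (\<lambda>i j. of_bool (i = j) :: complex)"
    by (auto simp: magic_unitary_def star_complex_def)
  from magic_seminorm_le_univ[OF magic_seminorm_free_eval[OF this], of "1 :: ('n \<times> 'n) free_star_algebra"]
  show ?thesis using cstar_seminorm_one[OF univ_seminorm_cstar, where 'a1 = 'n] by (intro antisym) simp_all
qed


section \<open>The algebra of continuous functions on the quantum permutation group\<close>

text \<open>
  The completion of the free *-algebra modulo the null space of the universal C*-seminorm, as
  Cauchy sequences modulo null sequences. The index set \<open>{1,\<dots>,N}\<close> is the finite type \<open>'n\<close>.
\<close>

definition univ_Cauchy :: "(nat \<Rightarrow> ('n::finite \<times> 'n) free_star_algebra) \<Rightarrow> bool" where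
  "univ_Cauchy X \<longleftrightarrow> (\<forall>e>0. \<exists>M. \<forall>m\<ge>M. \<forall>n\<ge>M. univ_seminorm (X m - X n) < e)"

definition completion_rel ::
    "(nat \<Rightarrow> ('n::finite \<times> 'n) free_star_algebra) \<Rightarrow> (nat \<Rightarrow> ('n \<times> 'n) free_star_algebra) \<Rightarrow> bool" where
  "completion_rel X Y \<longleftrightarrow>
     univ_Cauchy X \<and> univ_Cauchy Y \<and> (\<lambda>n. univ_seminorm (X n - Y n)) \<longlonglongrightarrow> 0"

lemmas us_add = cstar_seminorm_add[OF univ_seminorm_cstar]
  and us_scale = cstar_seminorm_scale[OF univ_seminorm_cstar]
  and us_mult = cstar_seminorm_mult[OF univ_seminorm_cstar]
  and us_star_mult = cstar_seminorm_star_mult[OF univ_seminorm_cstar]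
  and us_zero [simp] = cstar_seminorm_zero[OF univ_seminorm_cstar]
  and us_minus [simp] = cstar_seminorm_minus[OF univ_seminorm_cstar]
  and us_nonneg [simp] = cstar_seminorm_nonneg[OF univ_seminorm_cstar]
  and us_commute = cstar_seminorm_diff_commute[OF univ_seminorm_cstar]
  and us_triangle = cstar_seminorm_diff_triangle[OF univ_seminorm_cstar]
  and us_diff = cstar_seminorm_diff[OF univ_seminorm_cstar]
  and us_star [simp] = cstar_seminorm_star[OF univ_seminorm_cstar]

lemma us_add_diff:
  "univ_seminorm ((x + y) - (x' + y')) \<le> univ_seminorm (x - x') + univ_seminorm (y - y')"
  using us_add[of "x - x'" "y - y'"] by (simp add: algebra_simps)

lemma us_mult_diff:
  "univ_seminorm (x * y - x' * y') \<le>
     univ_seminorm x * univ_seminorm (y - y') + univ_seminorm (x - x') * univ_seminorm y'"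
proof -
  have "univ_seminorm (x * y - x' * y') = univ_seminorm (x * (y - y') + (x - x') * y')"
    by (simp add: algebra_simps)
  also have "\<dots> \<le> univ_seminorm (x * (y - y')) + univ_seminorm ((x - x') * y')" by (rule us_add)
  finally show ?thesis using us_mult[of x "y - y'"] us_mult[of "x - x'" y'] by linarith
qed

lemma univ_Cauchy_comparison:
  assumes X: "univ_Cauchy X" and Y: "univ_Cauchy Y" and B: "B > 0"
    and le: "\<And>m n. univ_seminorm (Z m - Z n) \<le>
      B * (univ_seminorm (X m - X n) + univ_seminorm (Y m - Y n))"
  shows "univ_Cauchy Z"
  unfolding univ_Cauchy_def
proof (intro allI impI)
  fix e :: real assume "e > 0"
  then have e: "e / (2 * B) > 0" using B by simp
  obtain M where M: "\<And>m n. m \<ge> M \<Longrightarrow> n \<ge> M \<Longrightarrow> univ_seminorm (X m - X n) < e / (2 * B)"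
    using X e unfolding univ_Cauchy_def by blast
  obtain M' where M': "\<And>m n. m \<ge> M' \<Longrightarrow> n \<ge> M' \<Longrightarrow> univ_seminorm (Y m - Y n) < e / (2 * B)"
    using Y e unfolding univ_Cauchy_def by blast
  have "univ_seminorm (Z m - Z n) < e" if "m \<ge> max M M'" "n \<ge> max M M'" for m n
  proof -
    have "univ_seminorm (X m - X n) + univ_seminorm (Y m - Y n) < e / B"
      using M[of m n] M'[of m n] that by (simp add: field_simps)
    then have "B * (univ_seminorm (X m - X n) + univ_seminorm (Y m - Y n)) < e"
      using B by (simp add: field_simps)
    then show ?thesis using le[of m n] by linarith
  qed
  then show "\<exists>M. \<forall>m\<ge>M. \<forall>n\<ge>M. univ_seminorm (Z m - Z n) < e" by blast
qed

lemma univ_Cauchy_const: "univ_Cauchy (\<lambda>_. x)"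
  by (simp add: univ_Cauchy_def)

lemma univ_Cauchy_convergent:
  assumes "univ_Cauchy X" shows "convergent (\<lambda>n. univ_seminorm (X n))"
proof (rule Cauchy_convergent, rule CauchyI)
  fix e :: real assume "e > 0"
  then obtain M where "\<forall>m\<ge>M. \<forall>n\<ge>M. univ_seminorm (X m - X n) < e"
    using assms unfolding univ_Cauchy_def by blast
  then show "\<exists>M. \<forall>m\<ge>M. \<forall>n\<ge>M. norm (univ_seminorm (X m) - univ_seminorm (X n)) < e"
    using us_diff by (metis real_norm_def order.strict_trans1)
qed

lemma univ_Cauchy_tendsto:
  "univ_Cauchy X \<Longrightarrow> (\<lambda>n. univ_seminorm (X n)) \<longlonglongrightarrow> lim (\<lambda>n. univ_seminorm (X n))"
  by (simp add: univ_Cauchy_convergent convergent_LIMSEQ_iff[symmetric])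

lemma univ_Cauchy_bound:
  assumes "univ_Cauchy X" obtains B where "B > 0" "\<And>n. univ_seminorm (X n) \<le> B"
  using convergent_imp_Bseq[OF univ_Cauchy_convergent[OF assms]]
  by (auto simp: Bseq_def)

lemma univ_Cauchy_add: "univ_Cauchy X \<Longrightarrow> univ_Cauchy Y \<Longrightarrow> univ_Cauchy (\<lambda>n. X n + Y n)"
  by (erule (1) univ_Cauchy_comparison[where B = 1]) (simp_all add: us_add_diff)

lemma univ_Cauchy_diff: "univ_Cauchy X \<Longrightarrow> univ_Cauchy Y \<Longrightarrow> univ_Cauchy (\<lambda>n. X n - Y n)"
  apply (erule (1) univ_Cauchy_comparison[where B = 1])
   apply simp
  subgoal for m n
    using us_add[of "X m - X n" "Y n - Y m"] by (simp add: algebra_simps us_commute[of "Y m"])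
  done

lemma univ_Cauchy_scale: "univ_Cauchy X \<Longrightarrow> univ_Cauchy (\<lambda>n. free_scale c (X n))"
  by (rule univ_Cauchy_comparison[where B = "cmod c + 1" and X = X and Y = X])
     (auto simp: us_scale add_nonneg_pos intro!: mult_mono simp flip: free_scale_diff)

lemma univ_Cauchy_star: "univ_Cauchy X \<Longrightarrow> univ_Cauchy (\<lambda>n. free_star (X n))"
  by (rule univ_Cauchy_comparison[where B = 1 and X = X and Y = X])
     (auto simp flip: free_star_diff)

lemma univ_Cauchy_mult:
  assumes X: "univ_Cauchy X" and Y: "univ_Cauchy Y"
  shows "univ_Cauchy (\<lambda>n. X n * Y n)"
proof -
  obtain B where B: "B > 0" "\<And>n. univ_seminorm (X n) \<le> B" using univ_Cauchy_bound[OF X] by blast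
  obtain C where C: "C > 0" "\<And>n. univ_seminorm (Y n) \<le> C" using univ_Cauchy_bound[OF Y] by blast
  show ?thesis
  proof (rule univ_Cauchy_comparison[OF X Y, where B = "B + C"])
    fix m n
    have "univ_seminorm (X m * Y m - X n * Y n) \<le>
        univ_seminorm (X m) * univ_seminorm (Y m - Y n) + univ_seminorm (X m - X n) * univ_seminorm (Y n)"
      by (rule us_mult_diff)
    also have "\<dots> \<le> (B + C) * univ_seminorm (Y m - Y n) + univ_seminorm (X m - X n) * (B + C)"
      using B C by (intro add_mono mult_mono) (auto intro: add_increasing add_increasing2 less_imp_le)
    finally show "univ_seminorm (X m * Y m - X n * Y n) \<le>
        (B + C) * (univ_seminorm (X m - X n) + univ_seminorm (Y m - Y n))"
      by (simp add: algebra_simps)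
  qed (use B C in simp)
qed

lemma us_null_comparison:
  assumes "f \<longlonglongrightarrow> 0" "\<And>n. univ_seminorm (Z n) \<le> f n"
  shows "(\<lambda>n. univ_seminorm (Z n)) \<longlonglongrightarrow> 0"
  by (rule Lim_null_comparison[OF _ assms(1)]) (simp add: assms(2))

lemma completion_rel_refl: "completion_rel X X \<longleftrightarrow> univ_Cauchy X"
  by (simp add: completion_rel_def)

lemma completion_rel_sym: "completion_rel X Y \<Longrightarrow> completion_rel Y X"
  by (simp add: completion_rel_def us_commute)

lemma completion_rel_trans:
  assumes "completion_rel X Y" "completion_rel Y Z" shows "completion_rel X Z"
proof -
  have "(\<lambda>n. univ_seminorm (X n - Y n) + univ_seminorm (Y n - Z n)) \<longlonglongrightarrow> 0"
    using assms by (auto simp: completion_rel_def intro: tendsto_add_zero)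
  then have "(\<lambda>n. univ_seminorm (X n - Z n)) \<longlonglongrightarrow> 0"
    by (rule us_null_comparison) (rule us_triangle)
  then show ?thesis using assms by (simp add: completion_rel_def)
qed

lemma completion_rel_add:
  assumes "completion_rel X X'" "completion_rel Y Y'"
  shows "completion_rel (\<lambda>n. X n + Y n) (\<lambda>n. X' n + Y' n)"
proof -
  have "(\<lambda>n. univ_seminorm (X n - X' n) + univ_seminorm (Y n - Y' n)) \<longlonglongrightarrow> 0"
    using assms by (auto simp: completion_rel_def intro: tendsto_add_zero)
  then have "(\<lambda>n. univ_seminorm (X n + Y n - (X' n + Y' n))) \<longlonglongrightarrow> 0"
    by (rule us_null_comparison) (rule us_add_diff)
  then show ?thesis using assms by (simp add: completion_rel_def univ_Cauchy_add)
qed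

lemma completion_rel_scale:
  assumes "completion_rel X X'"
  shows "completion_rel (\<lambda>n. free_scale c (X n)) (\<lambda>n. free_scale c (X' n))"
  using assms by (auto simp: completion_rel_def univ_Cauchy_scale us_scale
      simp flip: free_scale_diff intro: tendsto_mult_right_zero)

lemma completion_rel_star:
  assumes "completion_rel X X'"
  shows "completion_rel (\<lambda>n. free_star (X n)) (\<lambda>n. free_star (X' n))"
  using assms by (auto simp: completion_rel_def univ_Cauchy_star simp flip: free_star_diff)

lemma completion_rel_mult:
  assumes "completion_rel X X'" "completion_rel Y Y'"
  shows "completion_rel (\<lambda>n. X n * Y n) (\<lambda>n. X' n * Y' n)"
proof -
  have C: "univ_Cauchy X" "univ_Cauchy X'" "univ_Cauchy Y" "univ_Cauchy Y'"
    and 0: "(\<lambda>n. univ_seminorm (X n - X' n)) \<longlonglongrightarrow> 0" "(\<lambda>n. univ_seminorm (Y n - Y' n)) \<longlonglongrightarrow> 0"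
    using assms by (auto simp: completion_rel_def)
  have "(\<lambda>n. univ_seminorm (X n) * univ_seminorm (Y n - Y' n) +
             univ_seminorm (X n - X' n) * univ_seminorm (Y' n)) \<longlonglongrightarrow> 0"
    using tendsto_add[OF tendsto_mult[OF univ_Cauchy_tendsto[OF C(1)] 0(2)]
        tendsto_mult[OF 0(1) univ_Cauchy_tendsto[OF C(4)]]] by simp
  then have "(\<lambda>n. univ_seminorm (X n * Y n - X' n * Y' n)) \<longlonglongrightarrow> 0"
    by (rule us_null_comparison) (rule us_mult_diff)
  then show ?thesis using C by (simp add: completion_rel_def univ_Cauchy_mult)
qed

lemma completion_rel_norm:
  assumes "completion_rel X X'"
  shows "lim (\<lambda>n. univ_seminorm (X n)) = lim (\<lambda>n. univ_seminorm (X' n))"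
proof -
  have C: "univ_Cauchy X" "univ_Cauchy X'" and 0: "(\<lambda>n. univ_seminorm (X n - X' n)) \<longlonglongrightarrow> 0"
    using assms by (auto simp: completion_rel_def)
  have "(\<lambda>n. univ_seminorm (X n) - univ_seminorm (X' n)) \<longlonglongrightarrow> 0"
    by (rule Lim_null_comparison[OF _ 0]) (simp add: us_diff)
  moreover have "(\<lambda>n. univ_seminorm (X n) - univ_seminorm (X' n)) \<longlonglongrightarrow>
      lim (\<lambda>n. univ_seminorm (X n)) - lim (\<lambda>n. univ_seminorm (X' n))"
    using C by (intro tendsto_diff univ_Cauchy_tendsto)
  ultimately show ?thesis using LIMSEQ_unique by fastforce
qed

quotient_type 'n qperm_algebra =
    "nat \<Rightarrow> ('n::finite \<times> 'n) free_star_algebra" / partial: completion_rel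
proof (rule part_equivpI)
  show "\<exists>X. completion_rel X X" using univ_Cauchy_const by (auto simp: completion_rel_refl)
  show "symp completion_rel" by (auto intro!: sympI completion_rel_sym)
  show "transp completion_rel" by (auto intro!: transpI intro: completion_rel_trans)
qed

instantiation qperm_algebra :: (finite) real_normed_algebra_1
begin

lift_definition zero_qperm_algebra :: "'a qperm_algebra" is "\<lambda>_. 0"
  by (simp add: completion_rel_refl univ_Cauchy_const)

lift_definition one_qperm_algebra :: "'a qperm_algebra" is "\<lambda>_. 1"
  by (simp add: completion_rel_refl univ_Cauchy_const)

lift_definition plus_qperm_algebra :: "'a qperm_algebra \<Rightarrow> 'a qperm_algebra \<Rightarrow> 'a qperm_algebra"
  is "\<lambda>X Y n. X n + Y n"
  by (rule completion_rel_add)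

lift_definition uminus_qperm_algebra :: "'a qperm_algebra \<Rightarrow> 'a qperm_algebra"
  is "\<lambda>X n. - X n"
  by (drule completion_rel_scale[where c = "-1"]) (simp add: free_scale_minus)

definition minus_qperm_algebra :: "'a qperm_algebra \<Rightarrow> 'a qperm_algebra \<Rightarrow> 'a qperm_algebra"
  where "x - y = x + (- y)" for x y :: "'a qperm_algebra"

lift_definition times_qperm_algebra :: "'a qperm_algebra \<Rightarrow> 'a qperm_algebra \<Rightarrow> 'a qperm_algebra"
  is "\<lambda>X Y n. X n * Y n"
  by (rule completion_rel_mult)

lift_definition scaleR_qperm_algebra :: "real \<Rightarrow> 'a qperm_algebra \<Rightarrow> 'a qperm_algebra"
  is "\<lambda>r X n. free_scale (complex_of_real r) (X n)"
  by (rule completion_rel_scale)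

lift_definition norm_qperm_algebra :: "'a qperm_algebra \<Rightarrow> real"
  is "\<lambda>X. lim (\<lambda>n. univ_seminorm (X n))"
  by (rule completion_rel_norm)

definition dist_qperm_algebra :: "'a qperm_algebra \<Rightarrow> 'a qperm_algebra \<Rightarrow> real"
  where "dist x y = norm (x - y)" for x y :: "'a qperm_algebra"

definition sgn_qperm_algebra :: "'a qperm_algebra \<Rightarrow> 'a qperm_algebra"
  where "sgn x = inverse (norm x) *\<^sub>R x" for x :: "'a qperm_algebra"

definition uniformity_qperm_algebra :: "('a qperm_algebra \<times> 'a qperm_algebra) filter"
  where "uniformity_qperm_algebra = (INF e\<in>{0 <..}. principal {(x, y). dist x y < e})"

definition open_qperm_algebra :: "'a qperm_algebra set \<Rightarrow> bool"
  where "open_qperm_algebra U \<longleftrightarrow> (\<forall>x\<in>U. \<forall>\<^sub>F (x', y) in uniformity. x' = x \<longrightarrow> y \<in> U)"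

instance
proof
  fix x y z :: "'a qperm_algebra" and a b :: real and U :: "'a qperm_algebra set"
  show "x + y + z = x + (y + z)"
    by transfer (auto simp: add.assoc completion_rel_refl intro!: univ_Cauchy_add)
  show "x + y = y + x"
    by transfer (auto simp: add.commute completion_rel_refl intro!: univ_Cauchy_add)
  show "0 + x = x" by transfer simp
  show "- x + x = 0" by transfer (simp add: completion_rel_refl univ_Cauchy_const)
  show "x - y = x + - y" by (simp add: minus_qperm_algebra_def)
  show "x * y * z = x * (y * z)"
    by transfer (auto simp: mult.assoc completion_rel_refl intro!: univ_Cauchy_mult)
  show "1 * x = x" by transfer simp
  show "x * 1 = x" by transfer simp
  show "(x + y) * z = x * z + y * z"
    by transfer (auto simp: distrib_right completion_rel_refl intro!: univ_Cauchy_add univ_Cauchy_mult)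
  show "x * (y + z) = x * y + x * z"
    by transfer (auto simp: distrib_left completion_rel_refl intro!: univ_Cauchy_add univ_Cauchy_mult)
  show "a *\<^sub>R (x + y) = a *\<^sub>R x + a *\<^sub>R y"
    by transfer (auto simp: free_scale_add completion_rel_refl intro!: univ_Cauchy_add univ_Cauchy_scale)
  show "(a + b) *\<^sub>R x = a *\<^sub>R x + b *\<^sub>R x"
    by transfer (auto simp: free_scale_add_left completion_rel_refl intro!: univ_Cauchy_add univ_Cauchy_scale)
  show "a *\<^sub>R b *\<^sub>R x = (a * b) *\<^sub>R x"
    by transfer (auto simp: free_scale_scale completion_rel_refl intro!: univ_Cauchy_scale)
  show "1 *\<^sub>R x = x" by transfer simp
  show "a *\<^sub>R x * y = a *\<^sub>R (x * y)"
    by transfer (auto simp: free_scale_mult_left completion_rel_refl intro!: univ_Cauchy_scale univ_Cauchy_mult)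
  show "x * a *\<^sub>R y = a *\<^sub>R (x * y)"
    by transfer (auto simp: free_scale_mult_right completion_rel_refl intro!: univ_Cauchy_scale univ_Cauchy_mult)
  show "sgn x = inverse (norm x) *\<^sub>R x" by (rule sgn_qperm_algebra_def)
  show "dist x y = norm (x - y)" by (rule dist_qperm_algebra_def)
  show "(uniformity :: ('a qperm_algebra \<times> 'a qperm_algebra) filter) =
      (INF e\<in>{0 <..}. principal {(x, y). dist x y < e})"
    by (rule uniformity_qperm_algebra_def)
  show "open U \<longleftrightarrow> (\<forall>x\<in>U. \<forall>\<^sub>F (x', y) in uniformity. x' = x \<longrightarrow> y \<in> U)"
    by (rule open_qperm_algebra_def)
  show n1: "norm (1 :: 'a qperm_algebra) = 1"
    by transfer (simp add: univ_seminorm_one)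
  have n0: "norm (0 :: 'a qperm_algebra) = 0"
    by transfer simp
  show "(0 :: 'a qperm_algebra) \<noteq> 1" using n0 n1 by force
  show "norm x = 0 \<longleftrightarrow> x = 0"
  proof
    show "norm x = 0 \<Longrightarrow> x = 0"
      by transfer (use univ_Cauchy_tendsto in \<open>fastforce simp: completion_rel_def univ_Cauchy_const\<close>)
  qed (simp add: n0)
  show "norm (x + y) \<le> norm x + norm y"
    by transfer
       (rule LIMSEQ_le[OF univ_Cauchy_tendsto tendsto_add[OF univ_Cauchy_tendsto univ_Cauchy_tendsto]];
        auto simp: completion_rel_refl us_add intro!: univ_Cauchy_add)
  show "norm (x * y) \<le> norm x * norm y"
    by transfer
       (rule LIMSEQ_le[OF univ_Cauchy_tendsto tendsto_mult[OF univ_Cauchy_tendsto univ_Cauchy_tendsto]];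
        auto simp: completion_rel_refl us_mult intro!: univ_Cauchy_mult)
  show "norm (a *\<^sub>R x) = \<bar>a\<bar> * norm x"
    by transfer
       (auto simp: us_scale completion_rel_refl intro!: limI tendsto_mult_left univ_Cauchy_tendsto)
qed

end

definition qperm_of :: "('n::finite \<times> 'n) free_star_algebra \<Rightarrow> 'n qperm_algebra" where
  "qperm_of x = abs_qperm_algebra (\<lambda>_. x)"

lemma norm_qperm_of: "norm (qperm_of x) = univ_seminorm x"
  by (simp add: qperm_of_def norm_qperm_algebra.abs_eq completion_rel_refl univ_Cauchy_const)

lemma qperm_of_add: "qperm_of (x + y) = qperm_of x + qperm_of y"
  by (simp add: qperm_of_def plus_qperm_algebra.abs_eq completion_rel_refl univ_Cauchy_const)

lemma qperm_of_mult: "qperm_of (x * y) = qperm_of x * qperm_of y"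
  by (simp add: qperm_of_def times_qperm_algebra.abs_eq completion_rel_refl univ_Cauchy_const)

lemma qperm_of_one: "qperm_of 1 = 1"
  by (simp add: qperm_of_def one_qperm_algebra_def completion_rel_refl univ_Cauchy_const)

lemma qperm_of_diff: "qperm_of (x - y) = qperm_of x - qperm_of y"
  using qperm_of_add[of "x - y" y] by simp

lemma qperm_of_sum: "qperm_of (\<Sum>k\<in>A. f k) = (\<Sum>k\<in>A. qperm_of (f k))"
  using qperm_of_diff[of 0 0]
  by (induction A rule: infinite_finite_induct) (simp_all add: qperm_of_add)

lemma qperm_of_tendsto:
  assumes X: "univ_Cauchy X"
  shows "(\<lambda>n. qperm_of (X n)) \<longlonglongrightarrow> abs_qperm_algebra X"
proof (rule LIMSEQ_I)
  fix e :: real assume "e > 0"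
  then obtain M where M: "\<And>m n. m \<ge> M \<Longrightarrow> n \<ge> M \<Longrightarrow> univ_seminorm (X m - X n) < e / 2"
    using X unfolding univ_Cauchy_def by (metis half_gt_zero)
  have "norm (qperm_of (X n) - abs_qperm_algebra X) < e" if "n \<ge> M" for n
  proof -
    have C: "univ_Cauchy (\<lambda>m. X n - X m)"
      by (intro univ_Cauchy_diff univ_Cauchy_const X)
    have "qperm_of (X n) - abs_qperm_algebra X = abs_qperm_algebra (\<lambda>m. X n - X m)"
    proof -
      have "abs_qperm_algebra (\<lambda>m. X n - X m) + abs_qperm_algebra X =
          abs_qperm_algebra (\<lambda>m. (X n - X m) + X m)"
        using C X by (intro plus_qperm_algebra.abs_eq) (simp_all add: completion_rel_refl)
      then show ?thesis unfolding qperm_of_def diff_eq_eq by simp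
    qed
    moreover have "norm (abs_qperm_algebra (\<lambda>m. X n - X m)) = lim (\<lambda>m. univ_seminorm (X n - X m))"
      using C by (intro norm_qperm_algebra.abs_eq) (simp add: completion_rel_refl)
    moreover have "lim (\<lambda>m. univ_seminorm (X n - X m)) \<le> e / 2"
      using M[OF that] by (intro LIMSEQ_le_const2[OF univ_Cauchy_tendsto[OF C]]) (auto intro: less_imp_le)
    ultimately show ?thesis using \<open>e > 0\<close> by simp
  qed
  then show "\<exists>M. \<forall>n\<ge>M. norm (qperm_of (X n) - abs_qperm_algebra X) < e" by blast
qed

lemma qperm_algebra_cases:
  obtains X where "univ_Cauchy X" "x = abs_qperm_algebra X" "(\<lambda>n. qperm_of (X n)) \<longlonglongrightarrow> x"
  using Quotient_rep_reflp[OF Quotient_qperm_algebra, of x]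
    Quotient_abs_rep[OF Quotient_qperm_algebra, of x] qperm_of_tendsto[of "rep_qperm_algebra x"]
  by (auto simp: completion_rel_refl)

instance qperm_algebra :: (finite) banach
proof
  fix S :: "nat \<Rightarrow> 'a qperm_algebra" assume S: "Cauchy S"
  have "\<exists>a. norm (S k - qperm_of a) < inverse (real (Suc k))" for k
  proof -
    obtain X where "(\<lambda>n. qperm_of (X n)) \<longlonglongrightarrow> S k" by (rule qperm_algebra_cases)
    from LIMSEQ_D[OF this, of "inverse (real (Suc k))"] show ?thesis
      by (metis inverse_positive_iff_positive le_refl norm_minus_commute of_nat_0_less_iff zero_less_Suc)
  qed
  then obtain a where a: "\<And>k. norm (S k - qperm_of (a k)) < inverse (real (Suc k))" by metis
  have lim0: "(\<lambda>k. S k - qperm_of (a k)) \<longlonglongrightarrow> 0"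
    by (rule Lim_null_comparison[OF _ LIMSEQ_inverse_real_of_nat]) (use a in \<open>simp add: less_imp_le del: of_nat_Suc\<close>)
  have D: "Cauchy (\<lambda>k. S k - qperm_of (a k))"
    by (rule convergent_Cauchy) (use lim0 in \<open>auto simp: convergent_def\<close>)
  have "univ_Cauchy a"
    unfolding univ_Cauchy_def
  proof (intro allI impI)
    fix e :: real assume "e > 0"
    then have e: "e / 2 > 0" by simp
    obtain M where M: "\<And>m n. m \<ge> M \<Longrightarrow> n \<ge> M \<Longrightarrow> norm (S m - S n) < e / 2"
      using CauchyD[OF S e] by blast
    obtain M' where M': "\<And>m n. m \<ge> M' \<Longrightarrow> n \<ge> M' \<Longrightarrow>
        norm ((S m - qperm_of (a m)) - (S n - qperm_of (a n))) < e / 2"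
      using CauchyD[OF D e] by blast
    have "univ_seminorm (a m - a n) < e" if "m \<ge> max M M'" "n \<ge> max M M'" for m n
    proof -
      have "univ_seminorm (a m - a n) =
          norm ((S m - S n) - ((S m - qperm_of (a m)) - (S n - qperm_of (a n))))"
        by (simp add: algebra_simps qperm_of_diff flip: norm_qperm_of)
      also have "\<dots> < e"
        using norm_triangle_ineq4 M[of m n] M'[of m n] that
        by (smt (verit) field_sum_of_halves max.boundedE)
      finally show ?thesis .
    qed
    then show "\<exists>M. \<forall>m\<ge>M. \<forall>n\<ge>M. univ_seminorm (a m - a n) < e" by blast
  qed
  from tendsto_add[OF lim0 qperm_of_tendsto[OF this]] show "convergent S"
    by (auto simp: convergent_def)
qed

instantiation qperm_algebra :: (finite) cstar_algebra
begin

lift_definition scaleC_qperm_algebra :: "complex \<Rightarrow> 'a qperm_algebra \<Rightarrow> 'a qperm_algebra"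
  is "\<lambda>c X n. free_scale c (X n)"
  by (rule completion_rel_scale)

lift_definition star_qperm_algebra :: "'a qperm_algebra \<Rightarrow> 'a qperm_algebra"
  is "\<lambda>X n. free_star (X n)"
  by (rule completion_rel_star)

instance
proof
  fix x y :: "'a qperm_algebra" and a b :: complex and r :: real
  show "a *\<^sub>C (x + y) = a *\<^sub>C x + a *\<^sub>C y"
    by transfer (auto simp: free_scale_add completion_rel_refl intro!: univ_Cauchy_add univ_Cauchy_scale)
  show "(a + b) *\<^sub>C x = a *\<^sub>C x + b *\<^sub>C x"
    by transfer (auto simp: free_scale_add_left completion_rel_refl intro!: univ_Cauchy_add univ_Cauchy_scale)
  show "a *\<^sub>C b *\<^sub>C x = (a * b) *\<^sub>C x"
    by transfer (auto simp: free_scale_scale completion_rel_refl intro!: univ_Cauchy_scale)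
  show "complex_of_real r *\<^sub>C x = r *\<^sub>R x"
    by transfer (auto simp: completion_rel_refl intro!: univ_Cauchy_scale)
  show "(a *\<^sub>C x) * y = a *\<^sub>C (x * y)"
    by transfer (auto simp: free_scale_mult_left completion_rel_refl intro!: univ_Cauchy_scale univ_Cauchy_mult)
  show "x * (a *\<^sub>C y) = a *\<^sub>C (x * y)"
    by transfer (auto simp: free_scale_mult_right completion_rel_refl intro!: univ_Cauchy_scale univ_Cauchy_mult)
  show "norm (a *\<^sub>C x) = cmod a * norm x"
    by transfer
       (auto simp: us_scale completion_rel_refl intro!: limI tendsto_mult_left univ_Cauchy_tendsto)
  show "star (star x) = x" by transfer simp
  show "star (x + y) = star x + star y"
    by transfer (auto simp: free_star_add completion_rel_refl intro!: univ_Cauchy_add univ_Cauchy_star)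
  show "star (a *\<^sub>C x) = cnj a *\<^sub>C star x"
    by transfer (auto simp: free_star_scale completion_rel_refl intro!: univ_Cauchy_scale univ_Cauchy_star)
  show "star (x * y) = star y * star x"
    by transfer (auto simp: free_star_mult completion_rel_refl intro!: univ_Cauchy_mult univ_Cauchy_star)
  show "norm (star x * x) = (norm x)\<^sup>2"
    by transfer
       (auto simp: us_star_mult completion_rel_refl intro!: limI tendsto_power univ_Cauchy_tendsto)
qed

end

lemma qperm_of_star: "qperm_of (free_star x) = star (qperm_of x)"
  by (simp add: qperm_of_def star_qperm_algebra.abs_eq completion_rel_refl univ_Cauchy_const)

lemma qperm_of_scale: "qperm_of (free_scale c x) = c *\<^sub>C qperm_of x"
  by (simp add: qperm_of_def scaleC_qperm_algebra.abs_eq completion_rel_refl univ_Cauchy_const)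

definition qperm_gen :: "'n::finite \<Rightarrow> 'n \<Rightarrow> 'n qperm_algebra" where
  "qperm_gen i j = qperm_of (free_gen (i, j))"

lemma qperm_of_relation:
  assumes "x - y \<in> magic_relations" shows "qperm_of x = qperm_of y"
proof -
  have "norm (qperm_of (x - y)) = 0"
    using assms by (simp add: norm_qperm_of univ_seminorm_relation)
  then show ?thesis by (simp add: qperm_of_diff)
qed

theorem magic_unitary_qperm_gen: "magic_unitary qperm_gen"
proof -
  have "qperm_of (free_star (free_gen (i, j))) = qperm_of (free_gen (i, j))"
    "qperm_of (free_gen (i, j) * free_gen (i, j)) = qperm_of (free_gen (i, j))"
    "qperm_of (\<Sum>k\<in>UNIV. free_gen (i, k)) = qperm_of 1"
    "qperm_of (\<Sum>k\<in>UNIV. free_gen (k, j)) = qperm_of 1" for i j :: 'a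
    by (rule qperm_of_relation; unfold magic_relations_def; blast)+
  then show ?thesis
    by (simp add: magic_unitary_def qperm_gen_def qperm_of_star qperm_of_mult qperm_of_sum qperm_of_one)
qed

text \<open>
  The universal property. Continuity is automatic for *-homomorphisms between C*-algebras; it is
  included here only so that uniqueness can be obtained from density.
\<close>

theorem qperm_algebra_universal:
  fixes v :: "'n::finite \<Rightarrow> 'n \<Rightarrow> 'a::cstar_algebra"
  assumes v: "magic_unitary v"
  shows "\<exists>!\<phi> :: 'n qperm_algebra \<Rightarrow> 'a.
    unital_star_hom \<phi> \<and> continuous_on UNIV \<phi> \<and> (\<forall>i j. \<phi> (qperm_gen i j) = v i j)"
proof (rule ex_ex1I)
  let ?ev = "free_eval (\<lambda>(i, j). v i j)"
  define \<phi> where "\<phi> x = lim (\<lambda>n. ?ev (rep_qperm_algebra x n))" for x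
  have le: "norm (?ev x) \<le> univ_seminorm x" for x
    by (rule magic_seminorm_le_univ[OF magic_seminorm_free_eval[OF v]])
  have conv: "(\<lambda>n. ?ev (X n)) \<longlonglongrightarrow> \<phi> (abs_qperm_algebra X)" if X: "univ_Cauchy X" for X
  proof -
    let ?Y = "rep_qperm_algebra (abs_qperm_algebra X)"
    have "completion_rel ?Y X"
      using X Quotient_rep_abs[OF Quotient_qperm_algebra] by (simp add: completion_rel_refl)
    then have Y: "univ_Cauchy ?Y" and d: "(\<lambda>n. univ_seminorm (X n - ?Y n)) \<longlonglongrightarrow> 0"
      by (auto simp: completion_rel_def us_commute)
    have "Cauchy (\<lambda>n. ?ev (?Y n))"
      using Y le unfolding univ_Cauchy_def Cauchy_iff
      by (metis free_eval_diff order.strict_trans1)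
    then have "(\<lambda>n. ?ev (?Y n)) \<longlonglongrightarrow> \<phi> (abs_qperm_algebra X)"
      by (simp add: \<phi>_def Cauchy_convergent_iff convergent_LIMSEQ_iff)
    moreover have "(\<lambda>n. ?ev (X n) - ?ev (?Y n)) \<longlonglongrightarrow> 0"
      by (rule Lim_null_comparison[OF _ d]) (simp add: le flip: free_eval_diff)
    ultimately show ?thesis using tendsto_add by fastforce
  qed
  have of: "\<phi> (qperm_of x) = ?ev x" for x
    using LIMSEQ_unique[OF conv[OF univ_Cauchy_const[of x]] tendsto_const]
    by (simp add: qperm_of_def)
  have add: "\<phi> (x + y) = \<phi> x + \<phi> y" for x y
  proof -
    obtain X Y where *: "univ_Cauchy X" "x = abs_qperm_algebra X" "univ_Cauchy Y" "y = abs_qperm_algebra Y"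
      by (metis qperm_algebra_cases)
    have "x + y = abs_qperm_algebra (\<lambda>n. X n + Y n)"
      using * by (simp add: plus_qperm_algebra.abs_eq completion_rel_refl)
    moreover have "(\<lambda>n. ?ev (X n + Y n)) \<longlonglongrightarrow> \<phi> x + \<phi> y"
      using tendsto_add[OF conv[OF *(1)] conv[OF *(3)]] *(2,4) by (simp add: free_eval_add)
    ultimately show ?thesis
      using LIMSEQ_unique conv[OF univ_Cauchy_add[OF *(1,3)]] by metis
  qed
  have mult: "\<phi> (x * y) = \<phi> x * \<phi> y" for x y
  proof -
    obtain X Y where *: "univ_Cauchy X" "x = abs_qperm_algebra X" "univ_Cauchy Y" "y = abs_qperm_algebra Y"
      by (metis qperm_algebra_cases)
    have "x * y = abs_qperm_algebra (\<lambda>n. X n * Y n)"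
      using * by (simp add: times_qperm_algebra.abs_eq completion_rel_refl)
    moreover have "(\<lambda>n. ?ev (X n * Y n)) \<longlonglongrightarrow> \<phi> x * \<phi> y"
      using tendsto_mult[OF conv[OF *(1)] conv[OF *(3)]] *(2,4) by (simp add: free_eval_mult)
    ultimately show ?thesis
      using LIMSEQ_unique conv[OF univ_Cauchy_mult[OF *(1,3)]] by metis
  qed
  have norm: "norm (\<phi> x) \<le> norm x" for x
  proof -
    obtain X where *: "univ_Cauchy X" "x = abs_qperm_algebra X" by (metis qperm_algebra_cases)
    have "norm x = lim (\<lambda>n. univ_seminorm (X n))"
      using * by (simp add: norm_qperm_algebra.abs_eq completion_rel_refl)
    then show ?thesis
      using LIMSEQ_le[OF tendsto_norm[OF conv[OF *(1)]] univ_Cauchy_tendsto[OF *(1)]] le * by simp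
  qed
  have scale: "\<phi> (c *\<^sub>C x) = c *\<^sub>C \<phi> x" for c x
  proof -
    obtain X where *: "univ_Cauchy X" "x = abs_qperm_algebra X" by (metis qperm_algebra_cases)
    have "c *\<^sub>C x = abs_qperm_algebra (\<lambda>n. free_scale c (X n))"
      using * by (simp add: scaleC_qperm_algebra.abs_eq completion_rel_refl)
    moreover have "(\<lambda>n. ?ev (free_scale c (X n))) \<longlonglongrightarrow> c *\<^sub>C \<phi> x"
      using bounded_linear.tendsto[OF bounded_linear_scaleC conv[OF *(1)], of c] *(2)
      by (simp add: free_eval_scale)
    ultimately show ?thesis
      using LIMSEQ_unique conv[OF univ_Cauchy_scale[OF *(1)]] by metis
  qed
  have star: "\<phi> (star x) = star (\<phi> x)" for x
  proof -
    obtain X where *: "univ_Cauchy X" "x = abs_qperm_algebra X" by (metis qperm_algebra_cases)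
    have "star x = abs_qperm_algebra (\<lambda>n. free_star (X n))"
      using * by (simp add: star_qperm_algebra.abs_eq completion_rel_refl)
    moreover have "(\<lambda>n. ?ev (free_star (X n))) \<longlonglongrightarrow> star (\<phi> x)"
      using bounded_linear.tendsto[OF bounded_linear_star conv[OF *(1)]] *(2)
      by (simp add: free_eval_star)
    ultimately show ?thesis
      using LIMSEQ_unique conv[OF univ_Cauchy_star[OF *(1)]] by metis
  qed
  have one: "\<phi> 1 = 1" using of[of 1] by (simp add: qperm_of_one)
  have lin: "bounded_linear \<phi>"
  proof (rule bounded_linear_intro[where K = 1])
    show "\<phi> (r *\<^sub>R x) = r *\<^sub>R \<phi> x" for r x
      using scale[of "complex_of_real r" x] by (simp add: scaleC_of_real)
  qed (simp_all add: add norm)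
  have "unital_star_hom \<phi>"
    by (simp add: unital_star_hom_def add mult scale star one)
  moreover have "continuous_on UNIV \<phi>"
    by (rule bounded_linear.continuous_on[OF lin continuous_on_id])
  moreover have "\<forall>i j. \<phi> (qperm_gen i j) = v i j"
    by (simp add: qperm_gen_def of free_eval_gen)
  ultimately show "\<exists>\<phi> :: 'n qperm_algebra \<Rightarrow> 'a.
      unital_star_hom \<phi> \<and> continuous_on UNIV \<phi> \<and> (\<forall>i j. \<phi> (qperm_gen i j) = v i j)"
    by blast
next
  have determined: "\<psi> (qperm_of x) = free_eval (\<lambda>(i, j). v i j) x"
    if h: "unital_star_hom \<psi>" and g: "\<And>i j. \<psi> (qperm_gen i j) = v i j"
    for \<psi> :: "'n qperm_algebra \<Rightarrow> 'a" and x
  proof (induction x rule: free_induct)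
    case (single w c)
    have word: "\<psi> (qperm_of (Poly_Mapping.single (Word l) 1)) = word_eval (\<lambda>(i, j). v i j) l" for l
    proof (induction l)
      case Nil
      have "Poly_Mapping.single (Word []) 1 = (1 :: ('n \<times> 'n) free_star_algebra)"
        by (simp flip: zero_star_word_def)
      then show ?case using h by (simp add: qperm_of_one unital_star_hom_def)
    next
      case (Cons a l)
      obtain i j s where a: "a = ((i, j), s)" by (metis surj_pair)
      have "Poly_Mapping.single (Word (a # l)) (1::complex) =
          (if s then free_star (free_gen (i, j)) else free_gen (i, j)) * Poly_Mapping.single (Word l) 1"
        using a by (simp add: free_gen_def mult_single word_star_def[of "Word _"])
      then show ?case using h g[of i j, unfolded qperm_gen_def] a Cons
        by (simp add: qperm_of_mult qperm_of_star unital_star_hom_def)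
    qed
    obtain l where l: "w = Word l" by (cases w)
    have "Poly_Mapping.single w c = free_scale c (Poly_Mapping.single w 1)"
      by (simp add: free_scale_def mult_single)
    then have "\<psi> (qperm_of (Poly_Mapping.single w c)) = c *\<^sub>C \<psi> (qperm_of (Poly_Mapping.single w 1))"
      using h by (simp add: qperm_of_scale unital_star_hom_def)
    then show ?case by (simp add: word l free_eval_single)
  next
    case (add x y)
    then show ?case using h by (simp add: qperm_of_add free_eval_add unital_star_hom_def)
  qed
  fix \<phi> \<psi> :: "'n qperm_algebra \<Rightarrow> 'a"
  assume \<phi>: "unital_star_hom \<phi> \<and> continuous_on UNIV \<phi> \<and> (\<forall>i j. \<phi> (qperm_gen i j) = v i j)"
    and \<psi>: "unital_star_hom \<psi> \<and> continuous_on UNIV \<psi> \<and> (\<forall>i j. \<psi> (qperm_gen i j) = v i j)"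
  show "\<phi> = \<psi>"
  proof
    fix x :: "'n qperm_algebra"
    obtain X where X: "(\<lambda>n. qperm_of (X n)) \<longlonglongrightarrow> x" by (rule qperm_algebra_cases)
    have "(\<lambda>n. \<phi> (qperm_of (X n))) \<longlonglongrightarrow> \<phi> x" "(\<lambda>n. \<psi> (qperm_of (X n))) \<longlonglongrightarrow> \<psi> x"
      using \<phi> \<psi> X by (auto intro: continuous_on_tendsto_compose)
    moreover have "\<phi> (qperm_of a) = \<psi> (qperm_of a)" for a
      using \<phi> \<psi> determined by metis
    ultimately show "\<phi> x = \<psi> x" using LIMSEQ_unique by auto
  qed
qed

end

theory Submission
  imports Defs
begin

text \<open>
  The quantum permutation group has a flat matrix model: vectors \<open>\<xi>\<^sub>i\<^sub>j\<close> in \<open>\<complex>\<^sup>N\<close> such that every row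
  and every column of \<open>(\<xi>\<^sub>i\<^sub>j)\<close> is an orthonormal basis give a magic unitary of rank-one projections. A
  product of rank-one projections vanishes only if two consecutive vectors are orthogonal. So it is
  enough that \<open>\<xi>\<^sub>i\<^sub>j\<close> and \<open>\<xi>\<^sub>k\<^sub>l\<close> are never orthogonal for \<open>i \<noteq> k\<close> and \<open>j \<noteq> l\<close>.

  For \<open>N \<ge> 5\<close> take the products of the characters \<open>a \<mapsto> z\<^sup>a\<close> and \<open>a \<mapsto> w\<^bsup>\<tau>(a)\<^esup>\<close> of the cyclic
  group of order \<open>N\<close>, where \<open>\<tau>\<close> transposes 0 and 1. The inner products reduce to
  \<open>\<Sum>\<^sub>a z\<^sup>a w\<^bsup>\<tau>(a)\<^esup> = N [zw = 1] - (1 - z)(1 - w)\<close>, which is nonzero for \<open>z, w \<noteq> 1\<close> because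
  \<open>\<bar>1 - z\<bar>\<^sup>2 \<le> 4 < N\<close>. For \<open>N = 4\<close> take the quaternions \<open>\<xi>\<^sub>i\<^sub>j = e\<^sub>i (e\<^sub>1 + e\<^sub>2 + e\<^sub>3) e\<^sub>j / \<surd>3\<close>.
\<close>

section \<open>Rank-one projections\<close>

definition cip :: "complex ^ 'k::finite \<Rightarrow> complex ^ 'k \<Rightarrow> complex" where
  "cip u v = (\<Sum>a\<in>UNIV. cnj (u $ a) * v $ a)"

lemma cip_add_right: "cip u (v + w) = cip u v + cip u w"
  by (simp add: cip_def distrib_left sum.distrib)

lemma cip_scale_right: "cip u (c *s v) = c * cip u v"
  by (simp add: cip_def sum_distrib_left mult_ac)

lemma cip_zero_right: "cip u 0 = 0"
  by (simp add: cip_def)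

lemma cip_commute: "cip v u = cnj (cip u v)"
  by (simp add: cip_def mult_ac)

lemma cip_scale_left: "cip (c *s u) v = cnj c * cip u v"
  by (simp add: cip_def sum_distrib_left mult_ac)

text \<open>Operator norms and adjoints refer to the real inner product; for complex-linear maps,
  adjointness with respect to it and to \<open>cip\<close> agree.\<close>

lemma inner_eq_Re_cip: "u \<bullet> v = Re (cip u v)"
  by (simp add: inner_vec_def cip_def inner_complex_def)

lemma scaleR_conv_scale: "r *\<^sub>R v = complex_of_real r *s (v :: complex ^ 'k)"
  by (simp add: vec_eq_iff scaleR_conv_of_real[where x = "_ :: complex"])

lemma inner_scale_left: "(c *s u) \<bullet> v = u \<bullet> (cnj c *s (v :: complex ^ 'k::finite))"
  by (simp add: inner_eq_Re_cip cip_scale_left cip_scale_right)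

lemma norm_scale: "norm (c *s v) = cmod c * norm (v :: complex ^ 'k::finite)"
  by (simp add: norm_vec_def norm_mult L2_set_right_distrib)

definition proj :: "complex ^ 'k::finite \<Rightarrow> complex ^ 'k \<Rightarrow> complex ^ 'k" where
  "proj \<xi> v = cip \<xi> v *s \<xi>"

lemma proj_add: "proj \<xi> (u + v) = proj \<xi> u + proj \<xi> v"
  by (simp add: proj_def cip_add_right vector_sadd_rdistrib)

lemma proj_scale: "proj \<xi> (c *s v) = c *s proj \<xi> v"
  by (simp add: proj_def cip_scale_right vector_smult_assoc)

lemma inner_proj: "proj \<xi> u \<bullet> v = u \<bullet> proj \<xi> v"
  by (simp add: proj_def inner_eq_Re_cip cip_scale_left cip_scale_right
      cip_commute[of u \<xi>] mult.commute)

lemma proj_idem: "cip \<xi> \<xi> = 1 \<Longrightarrow> proj \<xi> (proj \<xi> v) = proj \<xi> v"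
  by (simp add: proj_def cip_scale_right)

text \<open>
  The matrix \<open>X\<close> with rows \<open>e\<^sub>k\<close> (conjugated) satisfies \<open>X X\<^sup>* = 1\<close>, hence also \<open>X\<^sup>* X = 1\<close>.
\<close>

lemma sum_proj_orthonormal:
  fixes e :: "'k::finite \<Rightarrow> complex ^ 'k"
  assumes e: "\<And>k l. cip (e k) (e l) = of_bool (k = l)"
  shows "(\<Sum>k\<in>UNIV. proj (e k) v) = v"
proof -
  define X :: "complex ^ 'k ^ 'k" where "X = (\<chi> k a. cnj (e k $ a))"
  define Y :: "complex ^ 'k ^ 'k" where "Y = (\<chi> a k. e k $ a)"
  have "X ** Y = mat 1"
    using e by (simp add: X_def Y_def matrix_matrix_mult_def mat_def vec_eq_iff cip_def)
  then have "Y *v (X *v v) = v"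
    by (metis matrix_left_right_inverse matrix_vector_mul_assoc matrix_vector_mul_lid)
  moreover have "Y *v (X *v v) = (\<Sum>k\<in>UNIV. proj (e k) v)"
    by (simp add: X_def Y_def matrix_vector_mult_def vec_eq_iff proj_def cip_def mult.commute)
  ultimately show ?thesis by simp
qed

text \<open>Each projection turns the neighbouring vector into a multiple of its own, with factor
  \<open>cip (\<xi> e) (\<xi> f)\<close>; \<open>c\<close> is the product of these nonzero
  factors.\<close>

lemma foldr_proj:
  assumes "es \<noteq> []" and "\<And>e. cip (\<xi> e) (\<xi> e) = 1"
    and "successively (\<lambda>e f. cip (\<xi> e) (\<xi> f) \<noteq> 0) es"
  shows "\<exists>c. c \<noteq> 0 \<and> foldr (\<lambda>e. proj (\<xi> e)) es (\<xi> (last es)) = c *s \<xi> (hd es)"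
  using assms(1,3)
proof (induction es rule: induct_list012)
  case (2 e)
  show ?case by (rule exI[of _ 1]) (simp add: proj_def assms(2))
next
  case (3 e f es)
  then obtain c where c: "c \<noteq> 0"
    "foldr (\<lambda>e. proj (\<xi> e)) (f # es) (\<xi> (last (f # es))) = c *s \<xi> f"
    by (auto simp del: foldr.simps last.simps)
  have "foldr (\<lambda>e. proj (\<xi> e)) (e # f # es) (\<xi> (last (e # f # es))) = proj (\<xi> e) (c *s \<xi> f)"
    using c(2) by simp
  also have "\<dots> = (c * cip (\<xi> e) (\<xi> f)) *s \<xi> e"
    by (simp add: proj_def cip_scale_right)
  finally show ?case
    using c(1) 3 by (intro exI[of _ "c * cip (\<xi> e) (\<xi> f)"]) simp
qed simp

section \<open>Seminorms from families of self-adjoint operators\<close>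

text \<open>Evaluates the free algebra at the operators \<open>P e\<close>. The adjoint mark
  \<open>s\<close> is ignored because each \<open>P e\<close> will be self-adjoint.\<close>

definition act ::
  "('e \<Rightarrow> complex ^ 'k \<Rightarrow> complex ^ 'k::finite) \<Rightarrow> 'e free_star_algebra \<Rightarrow> complex ^ 'k \<Rightarrow> complex ^ 'k" where
  "act P x v = (\<Sum>w\<in>Poly_Mapping.keys x.
     Poly_Mapping.lookup x w *s foldr (\<lambda>(e, s). P e) (letters w) v)"

lemma act_add: "act P (x + y) v = act P x v + act P y v"
  unfolding act_def by (rule linear_ext_add) (simp add: vector_sadd_rdistrib)

lemma act_single: "act P (Poly_Mapping.single w c) v = c *s foldr (\<lambda>(e, s). P e) (letters w) v"
  unfolding act_def by (rule linear_ext_single) simp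

lemma act_zero: "act P 0 v = 0"
  by (simp add: act_def)

lemma act_diff: "act P (x - y) v = act P x v - act P y v"
  using act_add[of P "x - y" y v] by simp

lemma act_sum: "act P (\<Sum>k\<in>A. f k) v = (\<Sum>k\<in>A. act P (f k) v)"
  by (induction A rule: infinite_finite_induct) (simp_all add: act_zero act_add)

lemma act_gen: "act P (free_gen e) v = P e v"
  by (simp add: free_gen_def act_single)

lemma act_one: "act P 1 v = v"
  using act_single[of P 0 1 v] by (simp flip: single_one add: zero_star_word_def)

text \<open>The C*-identity for operators, obtained by Cauchy-Schwarz.\<close>

lemma onorm_adjoint_compose:
  fixes f g :: "'a::real_inner \<Rightarrow> 'a"
  assumes f: "bounded_linear f" and g: "bounded_linear g"
    and adj: "\<And>u v. g u \<bullet> v = u \<bullet> f v"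
  shows "onorm (\<lambda>v. g (f v)) = (onorm f)\<^sup>2"
proof (rule antisym)
  have gf: "bounded_linear (\<lambda>v. g (f v))"
    by (rule bounded_linear_compose[OF g f])
  \<comment> \<open>An adjoint is no larger than the operator: cancel one factor
    \<open>norm (g u)\<close>.\<close>
  have "norm (g u) \<le> onorm f * norm u" for u
  proof (cases "g u = 0")
    case False
    have "norm (g u) * norm (g u) = u \<bullet> f (g u)"
      by (simp flip: adj power2_norm_eq_inner add: power2_eq_square)
    also have "\<dots> \<le> norm u * norm (f (g u))" by (rule norm_cauchy_schwarz)
    also have "\<dots> \<le> norm u * (onorm f * norm (g u))"
      by (intro mult_left_mono onorm[OF f]) simp
    finally show ?thesis using False by (simp add: mult_ac)
  qed (simp add: onorm_pos_le[OF f])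
  then have "onorm g \<le> onorm f" by (intro onorm_bound onorm_pos_le[OF f])
  then show "onorm (\<lambda>v. g (f v)) \<le> (onorm f)\<^sup>2"
    using onorm_compose[OF g f] mult_right_mono[OF _ onorm_pos_le[OF f], of "onorm g" "onorm f"]
    by (simp add: comp_def power2_eq_square)
  have "norm (f v) \<le> sqrt (onorm (\<lambda>v. g (f v))) * norm v" for v
  proof (rule power2_le_imp_le)
    have "(norm (f v))\<^sup>2 = g (f v) \<bullet> v"
      by (simp add: adj power2_norm_eq_inner)
    also have "\<dots> \<le> norm (g (f v)) * norm v" by (rule norm_cauchy_schwarz)
    also have "\<dots> \<le> (onorm (\<lambda>v. g (f v)) * norm v) * norm v"
      by (intro mult_right_mono onorm[OF gf]) simp
    also have "\<dots> = (sqrt (onorm (\<lambda>v. g (f v))) * norm v)\<^sup>2"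
      by (simp add: power_mult_distrib onorm_pos_le[OF gf] power2_eq_square[of "norm v"])
    finally show "(norm (f v))\<^sup>2 \<le> (sqrt (onorm (\<lambda>v. g (f v))) * norm v)\<^sup>2" .
  qed (simp add: onorm_pos_le[OF gf])
  then have "onorm f \<le> sqrt (onorm (\<lambda>v. g (f v)))" by (intro onorm_bound) (simp add: onorm_pos_le[OF gf])
  then have "(onorm f)\<^sup>2 \<le> (sqrt (onorm (\<lambda>v. g (f v))))\<^sup>2"
    by (rule power_mono[OF _ onorm_pos_le[OF f]])
  then show "(onorm f)\<^sup>2 \<le> onorm (\<lambda>v. g (f v))"
    by (simp add: onorm_pos_le[OF gf])
qed

context
  fixes P :: "'e \<Rightarrow> complex ^ 'k \<Rightarrow> complex ^ 'k::finite"
  assumes add: "\<And>e u v. P e (u + v) = P e u + P e v"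
    and scale: "\<And>e c v. P e (c *s v) = c *s P e v"
    and self_adjoint: "\<And>e u v. P e u \<bullet> v = u \<bullet> P e v"
begin

lemma foldr_act_add:
  "foldr (\<lambda>(e, s). P e) l (u + v) = foldr (\<lambda>(e, s). P e) l u + foldr (\<lambda>(e, s). P e) l v"
  by (induction l) (auto simp: add)

lemma foldr_act_scale: "foldr (\<lambda>(e, s). P e) l (c *s v) = c *s foldr (\<lambda>(e, s). P e) l v"
  by (induction l) (auto simp: scale)

lemma act_vec_add: "act P x (u + v) = act P x u + act P x v"
  by (simp add: act_def foldr_act_add vector_add_ldistrib sum.distrib)

lemma act_vec_scale: "act P x (c *s v) = c *s act P x v"
  by (induction x rule: free_induct)
     (simp_all add: act_single act_add foldr_act_scale vector_smult_assoc vector_add_ldistrib mult.commute)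

lemma act_mult: "act P (x * y) v = act P x (act P y v)"
proof (induction x rule: free_induct)
  case (single w c)
  show ?case
    by (induction y rule: free_induct)
       (simp_all add: distrib_left act_add act_vec_add mult_single act_single plus_star_word_def
          foldr_act_scale foldr_act_add vector_smult_assoc vector_add_ldistrib)
qed (simp_all add: distrib_right act_add)

text \<open>Moving self-adjoint factors across the inner product one at a time reverses the
  word.\<close>

lemma inner_foldr_act:
  "foldr (\<lambda>(e, s). P e) (letters (word_star w)) u \<bullet> v = u \<bullet> foldr (\<lambda>(e, s). P e) (letters w) v"
proof -
  have "foldr (\<lambda>(e, s). P e) (rev (map (\<lambda>(e, s). (e, \<not> s)) l)) u \<bullet> v =
      u \<bullet> foldr (\<lambda>(e, s). P e) l v" for l
    by (induction l arbitrary: u) (auto simp: self_adjoint)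
  then show ?thesis by (simp add: word_star_def)
qed

lemma inner_act_star: "act P (free_star x) u \<bullet> v = u \<bullet> act P x v"
  by (induction x rule: free_induct)
     (simp_all add: free_star_add act_add act_single inner_add_left inner_add_right
        inner_scale_left inner_foldr_act flip: foldr_act_scale)

lemma bounded_linear_act: "bounded_linear (act P x)"
  by (intro linear_conv_bounded_linear[THEN iffD1] linearI)
     (simp_all add: act_vec_add act_vec_scale scaleR_conv_scale)

lemma act_free_scale: "act P (free_scale c x) v = c *s act P x v"
  by (simp add: free_scale_def act_mult act_single zero_star_word_def)

lemma cstar_seminorm_act: "cstar_seminorm (\<lambda>x. onorm (act P x))"
  unfolding cstar_seminorm_def
proof (intro conjI allI)
  fix x y :: "'e free_star_algebra" and c :: complex
  note bl = bounded_linear_act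
  show "onorm (act P (x + y)) \<le> onorm (act P x) + onorm (act P y)"
    using onorm_triangle[OF bl bl, of x y] by (simp add: act_add[abs_def])
  show "onorm (act P (x * y)) \<le> onorm (act P x) * onorm (act P y)"
    using onorm_compose[OF bl bl, of x y] by (simp add: comp_def act_mult[abs_def])
  show "onorm (act P (free_star x * x)) = (onorm (act P x))\<^sup>2"
    using onorm_adjoint_compose[OF bl bl, of "free_star x" x]
    by (simp add: inner_act_star act_mult[abs_def])
  \<comment> \<open>\<open>onorm\<close> sees only norms of values, so the complex factor may be
    replaced by its modulus, a real scalar.\<close>
  have "onorm (act P (free_scale c x)) = onorm (\<lambda>v. cmod c *\<^sub>R act P x v)"
    by (simp add: onorm_def act_free_scale norm_scale)
  then show "onorm (act P (free_scale c x)) = cmod c * onorm (act P x)"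
    by (simp add: onorm_scaleR[OF bl])
qed

end

lemma magic_seminorm_act:
  fixes P :: "'n::finite \<times> 'n \<Rightarrow> complex ^ 'k \<Rightarrow> complex ^ 'k::finite"
  assumes add: "\<And>e u v. P e (u + v) = P e u + P e v"
    and scale: "\<And>e c v. P e (c *s v) = c *s P e v"
    and self_adjoint: "\<And>e u v. P e u \<bullet> v = u \<bullet> P e v"
    and idem: "\<And>e v. P e (P e v) = P e v"
    and row: "\<And>i v. (\<Sum>k\<in>UNIV. P (i, k) v) = v"
    and col: "\<And>j v. (\<Sum>k\<in>UNIV. P (k, j) v) = v"
  shows "magic_seminorm (\<lambda>x. onorm (act P x))"
proof -
  have star: "act P (free_star (free_gen e)) v = P e v" for e v
    by (simp add: free_gen_def act_single word_star_def)
  have "act P r v = 0" if "r \<in> magic_relations" for r v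
    using that unfolding magic_relations_def
    by (auto simp: act_diff act_mult[OF add scale self_adjoint] act_sum act_gen act_one star idem row col)
  then have "onorm (act P r) = 0" if "r \<in> magic_relations" for r
    using that by (simp add: onorm_eq_0[OF bounded_linear_act[OF add scale self_adjoint]])
  then show ?thesis
    by (simp add: magic_seminorm_def cstar_seminorm_act[OF add scale self_adjoint])
qed

text \<open>The norm of \<open>qperm_of x\<close> is the universal seminorm, which dominates the one
  coming from the model.\<close>

lemma act_eq_0_of_qperm_of_eq_0:
  assumes "magic_seminorm (\<lambda>x. onorm (act P x))" and "bounded_linear (act P x)"
    and "qperm_of x = 0"
  shows "act P x v = 0"
proof -
  have "onorm (act P x) \<le> univ_seminorm x"
    by (rule magic_seminorm_le_univ[OF assms(1)])
  also have "\<dots> = 0" using assms(3) by (metis norm_qperm_of norm_zero)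
  finally show ?thesis using assms(2) onorm_pos_le[OF assms(2)] onorm_eq_0 by fastforce
qed

section \<open>Flat magic bases\<close>

text \<open>The dimension equals the number of indices, so orthonormality alone makes every row and
  column a basis.\<close>

definition flat_magic_basis :: "('n::finite \<Rightarrow> 'n \<Rightarrow> complex ^ 'n) \<Rightarrow> bool" where
  "flat_magic_basis \<xi> \<longleftrightarrow>
     (\<forall>i j k l. (cip (\<xi> i j) (\<xi> i l) = of_bool (j = l)) \<and>
                (cip (\<xi> i j) (\<xi> k j) = of_bool (i = k)) \<and>
                (i \<noteq> k \<longrightarrow> j \<noteq> l \<longrightarrow> cip (\<xi> i j) (\<xi> k l) \<noteq> 0))"

section \<open>Characters of the cyclic group, for N at least 5\<close>

text \<open>The sum differs from the geometric sum of \<open>z * w\<close> only at the exponents 0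
  and 1; the change is w + z - 1 - zw.\<close>

lemma sum_twisted_roots_unity:
  fixes z w :: complex
  assumes N: "2 \<le> N" and z: "z ^ N = 1" and w: "w ^ N = 1"
  shows "(\<Sum>a<N. z ^ a * w ^ Transposition.transpose 0 1 a) = of_nat N * of_bool (z * w = 1) - (1 - z) * (1 - w)"
proof -
  from N have "\<exists>M. N = Suc (Suc M)" by presburger
  then obtain M where M: "N = Suc (Suc M)" ..
  have geom: "(\<Sum>a<N. (z * w) ^ a) = of_nat N * of_bool (z * w = 1)"
  proof (cases "z * w = 1")
    case False
    moreover have "(z * w) ^ N = 1" by (simp only: power_mult_distrib z w mult_1)
    ultimately show ?thesis using geometric_sum[OF False, of N] by simp
  qed simp
  have split: "(\<Sum>a<N. f a) = f 0 + f 1 + (\<Sum>a<M. f (Suc (Suc a)))" for f :: "nat \<Rightarrow> complex"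
    by (simp only: M sum.lessThan_Suc_shift) simp
  have "(\<Sum>a<N. z ^ a * w ^ Transposition.transpose 0 1 a) - (\<Sum>a<N. (z * w) ^ a) = w + z - 1 - z * w"
    unfolding split by (simp add: power_mult_distrib mult_ac)
  then show ?thesis
    unfolding geom by (simp add: algebra_simps)
qed

lemma flat_magic_basis_Fourier:
  assumes N: "CARD('n::finite) \<ge> 5"
  shows "\<exists>\<xi> :: 'n \<Rightarrow> 'n \<Rightarrow> complex ^ 'n. flat_magic_basis \<xi>"
proof -
  define N where "N = CARD('n)"
  \<comment> \<open>\<open>b\<close> numbers the coordinates by exponents, while \<open>r\<close>
    labels rows and columns by roots of unity.\<close>
  obtain b where b: "bij_betw b (UNIV :: 'n set) {..<N}"
    using ex_bij_betw_finite_nat[of "UNIV :: 'n set"] by (auto simp: N_def atLeast0LessThan)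
  have "card {z::complex. z ^ N = 1} = CARD('n)"
    using N card_roots_unity_eq[of N] by (simp add: N_def)
  then obtain r :: "'n \<Rightarrow> complex" where r: "bij_betw r UNIV {z. z ^ N = 1}"
    by (metis bij_betw_iff_card card.infinite finite zero_less_card_finite less_irrefl)
  have r1: "r i ^ N = 1" for i using r by (auto simp: bij_betw_def)
  have unit: "cmod (r i) = 1" for i
    using power_eq_1_iff[OF r1[of i]] N by (simp add: N_def)
  have cancel: "cnj (r i) * r i = 1" for i
    by (metis unit complex_norm_square mult.commute of_real_1 one_power2)
  have eq1: "cnj (r i) * r k = 1 \<longleftrightarrow> i = k" for i k
  proof
    assume "cnj (r i) * r k = 1"
    then have "r k = (r i * cnj (r i)) * r k" "r i * (cnj (r i) * r k) = r i"
      using cancel[of i] by (simp_all add: mult.commute)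
    then have "r k = r i" by (simp only: mult.assoc)
    then show "i = k" using r by (metis UNIV_I bij_betw_def inj_onD)
  qed (simp add: cancel)
  define \<xi> :: "'n \<Rightarrow> 'n \<Rightarrow> complex ^ 'n" where
    "\<xi> i j = (\<chi> k. r i ^ b k * r j ^ Transposition.transpose 0 1 (b k) / of_real (sqrt N))" for i j
  have "of_nat N * cip (\<xi> i j) (\<xi> k l) =
      (\<Sum>a\<in>UNIV. (cnj (r i) * r k) ^ b a * (cnj (r j) * r l) ^ Transposition.transpose 0 1 (b a))" for i j k l
    using N
    by (simp add: cip_def \<xi>_def sum_distrib_left power_mult_distrib mult_ac N_def flip: of_real_mult)
  also have "\<dots> i j k l = (\<Sum>a<N. (cnj (r i) * r k) ^ a * (cnj (r j) * r l) ^ Transposition.transpose 0 1 a)" for i j k l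
    by (rule sum.reindex_bij_betw[OF b])
  also have "\<dots> i j k l = of_nat N * of_bool ((cnj (r i) * r k) * (cnj (r j) * r l) = 1)
      - (1 - cnj (r i) * r k) * (1 - cnj (r j) * r l)" for i j k l
    using N by (intro sum_twisted_roots_unity)
      (simp_all add: power_mult_distrib r1 N_def[symmetric] flip: complex_cnj_power)
  finally have ip: "of_nat N * cip (\<xi> i j) (\<xi> k l) =
      of_nat N * of_bool ((cnj (r i) * r k) * (cnj (r j) * r l) = 1)
      - (1 - cnj (r i) * r k) * (1 - cnj (r j) * r l)" for i j k l .
  have N0: "of_nat N \<noteq> (0::complex)" using N by (simp add: N_def)
  \<comment> \<open>Equal indices make one of the two ratios 1, which kills the correction
    term.\<close>
  have "cip (\<xi> i j) (\<xi> i l) = of_bool (j = l)" for i j l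
    using ip[of i j i l] N0 by (simp add: cancel eq1)
  moreover have "cip (\<xi> i j) (\<xi> k j) = of_bool (i = k)" for i j k
    using ip[of i j k j] N0 by (simp add: cancel eq1)
  moreover have "cip (\<xi> i j) (\<xi> k l) \<noteq> 0" if "i \<noteq> k" "j \<noteq> l" for i j k l
  proof
    let ?z = "cnj (r i) * r k" and ?w = "cnj (r j) * r l"
    assume "cip (\<xi> i j) (\<xi> k l) = 0"
    then have *: "of_nat N * of_bool (?z * ?w = 1) = (1 - ?z) * (1 - ?w)"
      using ip[of i j k l] by simp
    moreover have "1 - ?z \<noteq> 0" "1 - ?w \<noteq> 0" using that eq1 by auto
    \<comment> \<open>The right side is nonzero, so the product of the ratios must be 1.\<close>
    ultimately have "of_nat N = (1 - ?z) * (1 - ?w)"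
      by (cases "?z * ?w = 1") (simp_all del: mult_cancel_left mult_cancel_right)
    then have "real N = cmod (1 - ?z) * cmod (1 - ?w)"
      by (metis norm_mult norm_of_nat)
    moreover have "cmod (1 - cnj (r p) * r q) \<le> 2" for p q
      using norm_triangle_ineq4[of 1 "cnj (r p) * r q"] by (simp add: norm_mult unit)
    then have "cmod (1 - ?z) * cmod (1 - ?w) \<le> 2 * 2" by (intro mult_mono) auto
    ultimately show False using N by (simp add: N_def)
  qed
  ultimately show ?thesis unfolding flat_magic_basis_def by blast
qed

section \<open>Quaternions, for N = 4\<close>

text \<open>
  The entry \<open>quat a b ! c\<close> is the coefficient at \<open>e\<^sub>c\<close> of the quaternion \<open>e\<^sub>a (e\<^sub>1 + e\<^sub>2 + e\<^sub>3) e\<^sub>b\<close>. Inner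
  products of these quaternions are up to sign and normalisation entries of the rotation by \<open>\<pi>\<close> around
  \<open>(1, 1, 1)\<close>, and none of those vanish.
\<close>

definition quat :: "nat \<Rightarrow> nat \<Rightarrow> int list" where
  "quat a b =
    [[[0, 1, 1, 1], [-1, 0, 1, -1], [-1, -1, 0, 1], [-1, 1, -1, 0]],
     [[-1, 0, -1, 1], [0, -1, 1, 1], [1, -1, -1, 0], [-1, -1, 0, -1]],
     [[-1, 1, 0, -1], [-1, -1, -1, 0], [0, 1, -1, 1], [1, 0, -1, -1]],
     [[-1, -1, 1, 0], [1, -1, 0, -1], [-1, 0, -1, -1], [0, 1, 1, -1]]] ! a ! b"

definition quat_inner :: "nat \<Rightarrow> nat \<Rightarrow> nat \<Rightarrow> nat \<Rightarrow> int" where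
  "quat_inner a b c d = (\<Sum>p<4. quat a b ! p * quat c d ! p)"

text \<open>Multiplication by a unit quaternion preserves inner products, and
  \<open>e\<^sub>1 + e\<^sub>2 + e\<^sub>3\<close> has squared length 3; this gives the value
  3.\<close>

lemma quat_inner:
  assumes "a < 4" "b < 4" "d < 4"
  shows "quat_inner a b a d = 3 * of_bool (b = d)"
    and "quat_inner b a d a = 3 * of_bool (b = d)"
    and "c < 4 \<Longrightarrow> a \<noteq> c \<Longrightarrow> b \<noteq> d \<Longrightarrow> quat_inner a b c d \<noteq> 0"
proof -
  \<comment> \<open>Quantifiers over lists let evaluation check all 256 quadruples.\<close>
  have "\<forall>a\<in>set [0..<4]. \<forall>b\<in>set [0..<4]. \<forall>c\<in>set [0..<4]. \<forall>d\<in>set [0..<4].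
      quat_inner a b a d = 3 * of_bool (b = d) \<and> quat_inner b a d a = 3 * of_bool (b = d) \<and>
      (a \<noteq> c \<longrightarrow> b \<noteq> d \<longrightarrow> quat_inner a b c d \<noteq> 0)"
    by code_simp
  with assms show "quat_inner a b a d = 3 * of_bool (b = d)"
    and "quat_inner b a d a = 3 * of_bool (b = d)"
    and "c < 4 \<Longrightarrow> a \<noteq> c \<Longrightarrow> b \<noteq> d \<Longrightarrow> quat_inner a b c d \<noteq> 0"
    by auto
qed

lemma flat_magic_basis_quaternion:
  assumes N: "CARD('n::finite) = 4"
  shows "\<exists>\<xi> :: 'n \<Rightarrow> 'n \<Rightarrow> complex ^ 'n. flat_magic_basis \<xi>"
proof -
  obtain b where b: "bij_betw b (UNIV :: 'n set) {..<4::nat}"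
    using ex_bij_betw_finite_nat[of "UNIV :: 'n set"] N by (metis atLeast0LessThan finite)
  have b4: "b i < 4" for i using b by (auto simp: bij_betw_def)
  have b_eq: "b i = b k \<longleftrightarrow> i = k" for i k
    using b by (auto simp: bij_betw_def inj_eq)
  define \<xi> :: "'n \<Rightarrow> 'n \<Rightarrow> complex ^ 'n" where
    "\<xi> i j = (\<chi> k. of_int (quat (b i) (b j) ! b k) / of_real (sqrt 3))" for i j
  have "3 * cip (\<xi> i j) (\<xi> k l) =
      (\<Sum>a\<in>UNIV. of_int (quat (b i) (b j) ! b a * quat (b k) (b l) ! b a))" for i j k l
    by (simp add: cip_def \<xi>_def sum_distrib_left flip: of_real_mult)
  also have "\<dots> i j k l = (\<Sum>p<4. of_int (quat (b i) (b j) ! p * quat (b k) (b l) ! p))" for i j k l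
    by (rule sum.reindex_bij_betw[OF b])
  finally have ip: "cip (\<xi> i j) (\<xi> k l) = of_int (quat_inner (b i) (b j) (b k) (b l)) / 3" for i j k l
    by (simp add: quat_inner_def field_simps)
  show ?thesis
    unfolding flat_magic_basis_def
    by (intro exI[of _ \<xi>] allI conjI impI) (simp_all add: ip quat_inner b4 b_eq)
qed

section \<open>Free orbitals\<close>

theorem theorem2p3:
  fixes i j :: "nat \<Rightarrow> 'n::finite" and m :: nat
  assumes "CARD('n) \<ge> 4"
    and "m \<ge> 1"
    and "prod_list (map (\<lambda>k. qperm_gen (i k) (j k)) [1..<Suc m]) = 0"
  shows "\<exists>n\<in>{1..m - 1}. (i n = i (n + 1)) \<noteq> (j n = j (n + 1))"
proof (rule ccontr)
  assume contr: "\<not> ?thesis"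
  have "CARD('n) = 4 \<or> CARD('n) \<ge> 5" using assms(1) by linarith
  then obtain \<xi> :: "'n \<Rightarrow> 'n \<Rightarrow> complex ^ 'n" where \<xi>: "flat_magic_basis \<xi>"
    using flat_magic_basis_Fourier[where 'n = 'n] flat_magic_basis_quaternion[where 'n = 'n] by blast
  define \<eta> where "\<eta> = (\<lambda>(a, b). \<xi> a b)"
  define P where "P e = proj (\<eta> e)" for e
  define es where "es = map (\<lambda>k. (i k, j k)) [1..<Suc m]"
  have row: "cip (\<xi> a b) (\<xi> a d) = of_bool (b = d)" and col: "cip (\<xi> a b) (\<xi> c b) = of_bool (a = c)"
    and flat: "a \<noteq> c \<Longrightarrow> b \<noteq> d \<Longrightarrow> cip (\<xi> a b) (\<xi> c d) \<noteq> 0" for a b c d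
    using \<xi> unfolding flat_magic_basis_def by blast+
  have unit: "cip (\<eta> e) (\<eta> e) = 1" for e
    by (cases e) (simp add: \<eta>_def row)
  have P: "P e (u + v) = P e u + P e v" "P e (c *s v) = c *s P e v" "P e u \<bullet> v = u \<bullet> P e v" for e c u v
    by (simp_all add: P_def proj_add proj_scale inner_proj)
  have magic: "magic_seminorm (\<lambda>x. onorm (act P x))"
  proof (rule magic_seminorm_act[OF P])
    show "P e (P e v) = P e v" for e v
      by (simp add: P_def proj_idem unit)
  qed (simp_all add: P_def \<eta>_def sum_proj_orthonormal row col)
  have bl: "bounded_linear (act P x)" for x
    by (rule bounded_linear_act[where P = P, OF P])
  have qp: "qperm_of (prod_list (map free_gen l)) = prod_list (map (\<lambda>(a, b). qperm_gen a b) l)"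
    for l :: "('n \<times> 'n) list"
    by (induction l) (auto simp: qperm_of_one qperm_of_mult qperm_gen_def)
  have "qperm_of (prod_list (map free_gen es)) = 0"
    unfolding qp using assms(3) by (simp add: es_def comp_def del: upt_Suc)
  then have zero: "act P (prod_list (map free_gen es)) v = 0" for v
    by (rule act_eq_0_of_qperm_of_eq_0[OF magic bl])
  have act: "act P (prod_list (map free_gen l)) v = foldr P l v" for l v
    by (induction l) (simp_all add: act_one act_mult[where P = P, OF P] act_gen)
  have "successively (\<lambda>e f. cip (\<eta> e) (\<eta> f) \<noteq> 0) es"
    unfolding successively_conv_nth
  proof (intro allI impI)
    fix n assume "Suc n < length es"
    \<comment> \<open>The list starts at index 1, so \<open>es ! n\<close> carries index
      \<open>Suc n\<close>.\<close>
    then have n: "Suc n < m" by (simp add: es_def del: upt_Suc)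
    then have "Suc n \<in> {1..m - 1}" by simp
    with contr have eq: "(i (Suc n) = i (Suc (Suc n))) = (j (Suc n) = j (Suc (Suc n)))"
      by (metis Suc_eq_plus1)
    \<comment> \<open>Consecutive pairs either coincide, giving a unit vector, or differ in both
      indices, where flatness applies.\<close>
    have "cip (\<xi> (i (Suc n)) (j (Suc n))) (\<xi> (i (Suc (Suc n))) (j (Suc (Suc n)))) \<noteq> 0"
    proof (cases "i (Suc n) = i (Suc (Suc n))")
      case True
      then show ?thesis using eq row by simp
    next
      case False
      then show ?thesis using eq flat by blast
    qed
    then show "cip (\<eta> (es ! n)) (\<eta> (es ! Suc n)) \<noteq> 0"
      using n by (simp add: es_def \<eta>_def del: upt_Suc)
  qed
  moreover have ne: "es \<noteq> []" using assms(2) by (simp add: es_def)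
  \<comment> \<open>Testing on the last vector shows that the monomial acts nontrivially.\<close>
  ultimately obtain c where c: "c \<noteq> 0" "foldr P es (\<eta> (last es)) = c *s \<eta> (hd es)"
    using foldr_proj[of es \<eta>] unit unfolding P_def[abs_def] by blast
  then have "c *s \<eta> (hd es) = 0" using zero act by metis
  then have "c * cip (\<eta> (hd es)) (\<eta> (hd es)) = 0"
    by (metis cip_scale_right cip_zero_right)
  then show False using c(1) by (simp add: unit)
qed

end
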